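(* Let $u$ be a weight on the unit disc $\mathbb{D}$ satisfying condition $B_2$, with $\mu=u\,dA$ a probability measure, and let $\nu$ be a Borel probability measure on $\mathbb{D}$. If the Berezin transform $\tilde\nu$ is bounded on $\mathbb{D}$, then $\nu$ is a $\mu$-Carleson measure.
   Context: $\mathbb{D}$ is the open unit disc in $\mathbb{C}$ and $dA$ is Lebesgue area measure on $\mathbb{D}$ normalized so that $A(\mathbb{D})=1$. A weight is an integrable function $u\in L^1(\mathbb{D},dA)$ with $u>0$ a.e. $A^2(u)$ is the Hilbert space of analytic functions $f$ on $\mathbb{D}$ with $\|f\|_{A^2(u)}^2=\int_{\mathbb{D}}|f|^2u\,dA<\infty$. Condition $B_2$ (Bekollé–Bonami): there is a constant $C>0$ such that for every interval (arc) $I\subset\partial\mathbb{D}$, $$\frac{1}{A(S(I))^2}\int_{S(I)}u\,dA\int_{S(I)}\frac1u\,dA\le C,$$ where $S(I)=\{\rho e^{it}: e^{it}\in I,\ 1-\frac{|I|}{2\pi}\le \rho<1\}$ and $|I|$ is the arc length of $I$. For $a\in\mathbb{D}$ let $B_a(z)=\frac{1}{(1-\overline{a}z)^2}$. The Berezin transform of $\nu$ is $$\tilde\nu(a)=\frac{1}{\|B_a\|_{A^2(u)}^2}\int_{\mathbb{D}}|B_a(z)|^2\,d\nu(z),\qquad a\in\mathbb{D}.$$ $\nu$ is a $\mu$-Carleson measure if there is a constant $C>0$ such that $\int_{\mathbb{D}}|f|^2\,d\nu\le C\int_{\mathbb{D}}|f|^2\,d\mu$ for every polynomial $f$. *)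

theory Defs
  imports "HOL-Probability.Probability" "HOL-Computational_Algebra.Polynomial"
begin

abbreviation unit_disc :: "complex set" where
  "unit_disc \<equiv> ball 0 1"

definition disc_area :: "complex measure" where
  "disc_area = uniform_measure (lebesgue_on unit_disc) unit_disc"

lemma space_disc_area: "space disc_area = unit_disc"
  by (simp add: disc_area_def)

lemma emeasure_disc_area:
  assumes "S \<in> sets lebesgue" "S \<subseteq> unit_disc"
  shows "emeasure disc_area S = emeasure lebesgue S / ennreal pi"
proof -
  have "emeasure lebesgue unit_disc = ennreal pi"
    using emeasure_ball[of 1 "0::complex"] by (simp add: unit_ball_vol_numeral(1)[of num.One])
  moreover have "unit_disc \<inter> S = S"
    using assms by auto
  ultimately show ?thesis
    using assms unfolding disc_area_def
    by (subst emeasure_uniform_measure) (auto simp: emeasure_restrict_space sets_restrict_space_iff)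
qed

definition disc_weight :: "(complex \<Rightarrow> real) \<Rightarrow> bool" where
  "disc_weight u \<longleftrightarrow> integrable disc_area u \<and> (AE z in disc_area. u z > 0)"

text \<open>
  An arc \<open>I\<close> of the unit circle is given as \<open>I = cis ` J\<close> for a real interval \<open>J\<close> (of any kind, open
  or closed at either end) with \<open>0 < |J| \<le> 2 * pi\<close>, so that the arc length of \<open>I\<close> is the length
  of \<open>J\<close>. Arcs consisting of one point, for which the quotient in condition \<open>B\<^sub>2\<close> is \<open>0 / 0\<close>, are
  left out.
\<close>

definition arc_interval :: "real set \<Rightarrow> bool" where
  "arc_interval J \<longleftrightarrow> is_interval J \<and> bounded J \<and>
     0 < measure lborel J \<and> measure lborel J \<le> 2 * pi"

definition carleson_box :: "real set \<Rightarrow> complex set" where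
  "carleson_box J =
     {of_real \<rho> * cis t | \<rho> t. t \<in> J \<and> 1 - measure lborel J / (2 * pi) \<le> \<rho> \<and> \<rho> < 1}"

text \<open>
  The integrals are taken in the extended nonnegative reals, so that the condition includes the
  integrability of \<open>1 / u\<close> over every box.
\<close>

definition B2_condition :: "(complex \<Rightarrow> real) \<Rightarrow> bool" where
  "B2_condition u \<longleftrightarrow> (\<exists>C>0. \<forall>J. arc_interval J \<longrightarrow>
     (\<integral>\<^sup>+z\<in>carleson_box J. ennreal (u z) \<partial>disc_area) *
     (\<integral>\<^sup>+z\<in>carleson_box J. ennreal (1 / u z) \<partial>disc_area) /
     (emeasure disc_area (carleson_box J))\<^sup>2 \<le> ennreal C)"

text \<open>
  The norm of \<open>A\<^sup>2(u)\<close>. It is only meaningful for \<open>f\<close> in \<open>A\<^sup>2(u)\<close>; this holds for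
  every \<open>bergman_kernel a\<close> with \<open>a\<close> in the disc, which is holomorphic and bounded there.
\<close>

definition A2_norm :: "(complex \<Rightarrow> real) \<Rightarrow> (complex \<Rightarrow> complex) \<Rightarrow> real" where
  "A2_norm u f = sqrt (\<integral>z. (cmod (f z))\<^sup>2 * u z \<partial>disc_area)"

definition bergman_kernel :: "complex \<Rightarrow> complex \<Rightarrow> complex" where
  "bergman_kernel a z = 1 / (1 - cnj a * z)\<^sup>2"

definition berezin_transform ::
  "(complex \<Rightarrow> real) \<Rightarrow> complex measure \<Rightarrow> complex \<Rightarrow> real" where
  "berezin_transform u \<nu> a =
     1 / (A2_norm u (bergman_kernel a))\<^sup>2 * (\<integral>z. (cmod (bergman_kernel a z))\<^sup>2 \<partial>\<nu>)"

definition carleson_measure :: "complex measure \<Rightarrow> complex measure \<Rightarrow> bool" where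
  "carleson_measure \<mu> \<nu> \<longleftrightarrow> (\<exists>C>0. \<forall>p :: complex poly.
     (\<integral>\<^sup>+z. ennreal ((cmod (poly p z))\<^sup>2) \<partial>\<nu>) \<le>
     ennreal C * (\<integral>\<^sup>+z. ennreal ((cmod (poly p z))\<^sup>2) \<partial>\<mu>))"

end

theory Submission
  imports Defs
begin

text \<open>
  For \<open>a\<close> in the disc put \<open>h = 1 - |a|\<close>, let \<open>K r\<close> be the part of the disc within
  distance \<open>r\<close> of \<open>a\<close>, and let \<open>\<mu> = u dA\<close>, \<open>\<kappa> = (1/u) dA\<close>. Condition \<open>B\<^sub>2\<close> says that
  \<open>\<mu> (K r) \<kappa> (K r)\<close> is at most a multiple of \<open>r^4\<close> whenever \<open>r \<ge> h\<close>, while Cauchy-Schwarz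
  bounds \<open>\<mu> E \<kappa> E\<close> from below by \<open>A(E)^2\<close>.

  Since \<open>|1 - cnj a * z| \<ge> max h |z - a|\<close>, the integral of \<open>|B\<^sub>a|\<^sup>2\<close> against \<open>\<mu>\<close> is controlled by the sum of
  \<open>\<mu> (K (2^k h)) / (2^k h)^4\<close>. Doubling of \<open>\<mu>\<close> alone makes all these terms comparable, and the
  sum would diverge logarithmically. But \<open>\<kappa>\<close> is reverse doubling, \<open>\<kappa> (K (r/2)) \<le> q \<kappa> (K r)\<close> with
  \<open>q < 1\<close>, because \<open>K r\<close> minus \<open>K (r/2)\<close> carries a fixed part of \<open>\<kappa> (K r)\<close>; through \<open>B\<^sub>2\<close> this gives
  the \<open>k\<close>-th term an extra factor \<open>q^k\<close>. Hence the norm of \<open>B\<^sub>a\<close> squared is at most a multiple of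
  \<open>\<mu> (K h) / h^4\<close>, and a bounded Berezin transform yields \<open>\<nu> (K h) \<le> M \<mu> (K h)\<close>.

  The Carleson inequality follows by integrating the sub-mean value property
  \<open>|p z|\<^sup>2 \<mu> (K h) \<le> c \<integral>|p|\<^sup>2 d\<mu>\<close> (integral over a disc of radius \<open>h/2\<close> about \<open>z\<close>) in \<open>\<nu>\<close> and exchanging the
  integrals.
\<close>

section \<open>The area mean value property of polynomials\<close>

text \<open>A rotation of the plane is an orthogonal map, and orthogonal maps of
  \<open>real^2\<close> preserve Lebesgue measure. This is transported to the complex plane on
  boxes, whose measures determine \<open>lborel\<close>.\<close>

lemma distr_lborel_rotate:
  fixes c :: complex
  assumes "cmod c = 1"
  shows "distr lborel borel (\<lambda>w. c * w) = lborel"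
proof -
  define \<phi> where "\<phi> x = Complex (x $ 1) (x $ 2)" for x :: "real^2"
  define \<psi> where "\<psi> z = (vector [Re z, Im z] :: real^2)" for z
  have \<phi>\<psi>: "\<phi> (\<psi> z) = z" for z
    by (simp add: \<phi>_def \<psi>_def)
  have \<psi>\<phi>: "\<psi> (\<phi> x) = x" for x
    by (simp add: \<phi>_def \<psi>_def vec_eq_iff forall_2)
  have \<phi>_cont: "continuous_on UNIV \<phi>"
    unfolding \<phi>_def by (auto intro!: continuous_intros)
  then have \<phi>_meas [measurable]: "\<phi> \<in> borel \<rightarrow>\<^sub>M borel"
    by (rule borel_measurable_continuous_onI)
  have norm_\<phi>: "norm (\<phi> x) = norm x" for x
    by (simp add: \<phi>_def norm_vec_def L2_set_def cmod_def sum_2)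
  have Basis2: "(Basis :: (real^2) set) = {axis 1 1, axis 2 1}"
    by (auto simp: Basis_vec_def UNIV_2)
  have \<phi>_box: "\<phi> -` box l u = box (\<psi> l) (\<psi> u)" for l u
    by (auto simp: \<phi>_def \<psi>_def mem_box Basis2 inner_axis Basis_complex_def)
  \<comment> \<open>The identification of \<open>real^2\<close> with the plane matches boxes with
    boxes of the same side lengths.\<close>
  have lborel_\<phi>: "lborel = distr lborel borel \<phi>"
  proof (rule lborel_eqI)
    fix l u :: complex
    assume le: "\<And>b. b \<in> Basis \<Longrightarrow> l \<bullet> b \<le> u \<bullet> b"
    from le[of 1] le[of \<i>] have le': "Re l \<le> Re u" "Im l \<le> Im u"
      by (auto simp: Basis_complex_def)
    have "emeasure (distr lborel borel \<phi>) (box l u) = emeasure lborel (box (\<psi> l) (\<psi> u))"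
      by (subst emeasure_distr) (auto simp: \<phi>_box)
    also have "\<dots> = (\<Prod>b\<in>Basis. (\<psi> u - \<psi> l) \<bullet> b)"
      using le' by (subst emeasure_lborel_box)
        (auto simp: Basis2 inner_axis \<psi>_def)
    also have "(\<Prod>b\<in>Basis. (\<psi> u - \<psi> l) \<bullet> b) = (\<Prod>b\<in>Basis. (u - l) \<bullet> b)"
      by (simp add: Basis2 axis_eq_axis inner_axis \<psi>_def Basis_complex_def)
    finally show "emeasure (distr lborel borel \<phi>) (box l u) = (\<Prod>b\<in>Basis. (u - l) \<bullet> b)" .
  qed auto
  show ?thesis
  proof (rule lborel_eqI[symmetric])
    fix l u :: complex
    assume le: "\<And>b. b \<in> Basis \<Longrightarrow> l \<bullet> b \<le> u \<bullet> b"
    \<comment> \<open>The inverse rotation read on \<open>real^2\<close>: preimages of boxes under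
      the rotation become images under \<open>g\<close>, to which orthogonal invariance
      applies.\<close>
    define g where "g x = \<psi> (inverse c * \<phi> x)" for x
    have c0: "c \<noteq> 0" using assms by auto
    have lin: "linear g"
      by (rule linearI) (auto simp: g_def \<phi>_def \<psi>_def vec_eq_iff forall_2 algebra_simps add_divide_distrib)
    have "norm (\<psi> z) = norm z" for z
      using norm_\<phi>[of "\<psi> z"] by (simp add: \<phi>\<psi>)
    then have "norm (g x) = norm x" for x
      using assms by (simp add: g_def norm_mult norm_inverse norm_\<phi>)
    with lin have g: "orthogonal_transformation g"
      by (simp add: orthogonal_transformation)
    have [measurable]: "(\<lambda>w. c * w) \<in> borel \<rightarrow>\<^sub>M borel" by measurable
    have eq: "\<phi> -` ((\<lambda>w. c * w) -` box l u) = g ` box (\<psi> l) (\<psi> u)"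
    proof (intro set_eqI iffI)
      fix x assume x: "x \<in> \<phi> -` ((\<lambda>w. c * w) -` box l u)"
      define y where "y = \<psi> (c * \<phi> x)"
      have "g y = x" by (simp add: g_def y_def \<phi>\<psi> \<psi>\<phi> c0 flip: mult.assoc)
      moreover have "y \<in> box (\<psi> l) (\<psi> u)"
        using x unfolding \<phi>_box[symmetric] by (simp add: y_def \<phi>\<psi>)
      ultimately show "x \<in> g ` box (\<psi> l) (\<psi> u)" by blast
    next
      fix x assume "x \<in> g ` box (\<psi> l) (\<psi> u)"
      then obtain y where y: "y \<in> \<phi> -` box l u" "x = g y" unfolding \<phi>_box by blast
      then have "c * \<phi> x = \<phi> y" by (simp add: g_def \<phi>\<psi> c0)
      with y show "x \<in> \<phi> -` ((\<lambda>w. c * w) -` box l u)" by simp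
    qed
    have meas: "(\<lambda>w. c * w) -` box l u \<in> sets borel"
      using measurable_sets[of "\<lambda>w. c * w" borel borel "box l u"] by simp
    have meas': "\<phi> -` ((\<lambda>w. c * w) -` box l u) \<in> sets borel"
      using measurable_sets[OF \<phi>_meas meas] by simp
    have "emeasure (distr lborel borel (\<lambda>w. c * w)) (box l u) =
        emeasure (distr lborel borel \<phi>) ((\<lambda>w. c * w) -` box l u)"
      by (subst lborel_\<phi>, subst emeasure_distr) (auto simp: meas)
    also have "\<dots> = emeasure lborel (g ` box (\<psi> l) (\<psi> u))"
      using meas by (subst emeasure_distr) (auto simp: eq)
    also have "\<dots> = emeasure lebesgue (g ` box (\<psi> l) (\<psi> u))"
      using meas' by (simp add: eq)
    also have "\<dots> = emeasure lebesgue (box (\<psi> l) (\<psi> u))"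
      using measurable_orthogonal_image[OF g, of "box (\<psi> l) (\<psi> u)"]
        measure_orthogonal_image[OF g, of "box (\<psi> l) (\<psi> u)"]
      by (simp add: emeasure_eq_measure2 lmeasurable_box fmeasurableD)
    also have "\<dots> = emeasure (distr lborel borel \<phi>) (box l u)"
      by (subst emeasure_distr) (auto simp: \<phi>_box)
    also have "\<dots> = (\<Prod>b\<in>Basis. (u - l) \<bullet> b)"
      unfolding lborel_\<phi>[symmetric] using le by (simp add: emeasure_lborel_box)
    finally show "emeasure (distr lborel borel (\<lambda>w. c * w)) (box l u) = (\<Prod>b\<in>Basis. (u - l) \<bullet> b)" .
  qed auto
qed

text \<open>With \<open>z\<close> moved to the origin, multiplication by a root of unity preserves
  both the disc and the area. The integral of |p| is therefore unchanged when the integrand is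
  replaced by the average of its rotates, and by the triangle inequality that average is at least |p
  z|.\<close>

lemma poly_sub_mean_value_ball:
  fixes p :: "complex poly"
  assumes "0 < r"
  shows "ennreal (pi * r\<^sup>2) * ennreal (cmod (poly p z)) \<le>
    (\<integral>\<^sup>+w\<in>ball z r. ennreal (cmod (poly p w)) \<partial>lborel)"
proof -
  define q where "q = pcompose p [:z, 1:]"
  have q: "poly q w = poly p (z + w)" for w
    by (simp add: q_def poly_pcompose)
  define N where "N = Suc (degree q)"
  define \<omega> where "\<omega> = cis (2 * pi / N)"
  have N0: "0 < N" by (simp add: N_def)
  \<comment> \<open>Averaging over the \<open>N\<close>-th roots of unity removes all nonconstant terms, as \<open>N > degree q\<close>.\<close>
  have mean: "(\<Sum>j<N. poly q (\<omega> ^ j * w)) = of_nat N * poly p z" for w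
  proof -
    have sum_root: "(\<Sum>j<N. (\<omega> ^ k) ^ j) = (if k = 0 then of_nat N else 0)" if "k < N" for k
    proof (cases "k = 0")
      case False
      \<comment> \<open>Otherwise \<open>N\<close> would divide \<open>k\<close>, although
        \<open>0 < k < N\<close>.\<close>
      have "\<omega> ^ k \<noteq> 1"
      proof
        assume "\<omega> ^ k = 1"
        then have "cis (real k * (2 * pi / N)) = 1"
          unfolding \<omega>_def Complex.DeMoivre .
        then have "cos (2 * pi * k / N) = 1"
          by (simp add: complex_eq_iff mult_ac)
        then obtain n :: int where "2 * pi * k / N = of_int n * 2 * pi"
          unfolding cos_one_2pi_int by auto
        then have "real k = of_int n * real N"
          using N0 by (simp add: field_simps)
        then have "int k = n * int N"
          by (metis of_int_eq_iff of_int_mult of_int_of_nat_eq)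
        then show False
          using that False by (metis N0 gr0I int_dvd_int_iff dvd_triv_right dvd_imp_le not_less)
      qed
      moreover have "(\<omega> ^ k) ^ N = 1"
      proof -
        have "\<omega> ^ N = 1"
          using N0 by (simp add: \<omega>_def Complex.DeMoivre)
        then show ?thesis
          by (metis power_mult mult.commute power_one)
      qed
      ultimately show ?thesis
        using False by (simp add: geometric_sum)
    qed auto
    have "(\<Sum>j<N. poly q (\<omega> ^ j * w)) = (\<Sum>j<N. \<Sum>k<N. coeff q k * w ^ k * (\<omega> ^ k) ^ j)"
      unfolding poly_altdef N_def lessThan_Suc_atMost
      by (intro sum.cong refl) (simp add: power_mult_distrib mult_ac flip: power_mult)
    also have "\<dots> = (\<Sum>k<N. coeff q k * w ^ k * (\<Sum>j<N. (\<omega> ^ k) ^ j))"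
      by (subst sum.swap) (simp add: sum_distrib_left)
    also have "\<dots> = (\<Sum>k<N. if k = 0 then coeff q 0 * of_nat N else 0)"
      by (intro sum.cong refl) (simp add: sum_root)
    also have "\<dots> = of_nat N * poly p z"
      using N0 q[of 0] by (simp add: poly_0_coeff_0)
    finally show ?thesis .
  qed
  define F where "F w = ennreal (cmod (poly p (z + w))) * indicator (ball 0 r) w" for w
  have F_meas [measurable]: "F \<in> borel_measurable borel"
  proof -
    have [measurable]: "(\<lambda>w. poly p (z + w)) \<in> borel_measurable borel"
      by (intro borel_measurable_continuous_onI continuous_intros)
    show ?thesis
      unfolding F_def by (intro borel_measurable_times_ennreal borel_measurable_indicator) auto
  qed
  have F_rotate: "(\<integral>\<^sup>+w. F (\<omega> ^ j * w) \<partial>lborel) = (\<integral>\<^sup>+w. F w \<partial>lborel)" for j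
  proof -
    have "cmod (\<omega> ^ j) = 1" by (simp add: \<omega>_def norm_power)
    then have "(\<integral>\<^sup>+w. F w \<partial>lborel) = (\<integral>\<^sup>+w. F w \<partial>distr lborel borel (\<lambda>w. \<omega> ^ j * w))"
      by (simp add: distr_lborel_rotate)
    also have "\<dots> = (\<integral>\<^sup>+w. F (\<omega> ^ j * w) \<partial>lborel)"
      by (rule nn_integral_distr) auto
    finally show ?thesis ..
  qed
  \<comment> \<open>Sums with the factor \<open>N\<close> stand in for averages; the factor is
    cancelled at the end.\<close>
  have "of_nat N * (ennreal (pi * r\<^sup>2) * ennreal (cmod (poly p z))) =
      (\<integral>\<^sup>+w. ennreal (of_nat N * cmod (poly p z)) * indicator (ball 0 r) w \<partial>(lborel :: complex measure))"
    using assms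
    by (subst nn_integral_cmult_indicator)
      (simp_all add: emeasure_ball unit_ball_vol_2 ennreal_mult ennreal_of_nat_eq_real_of_nat mult_ac)
  also have "\<dots> \<le> (\<integral>\<^sup>+w. (\<Sum>j<N. F (\<omega> ^ j * w)) \<partial>lborel)"
  proof (rule nn_integral_mono)
    fix w :: complex
    have "of_nat N * cmod (poly p z) = cmod (\<Sum>j<N. poly q (\<omega> ^ j * w))"
      by (simp add: mean norm_mult)
    also have "\<dots> \<le> (\<Sum>j<N. cmod (poly p (z + \<omega> ^ j * w)))"
      unfolding q by (rule norm_sum)
    finally have "ennreal (of_nat N * cmod (poly p z)) \<le> (\<Sum>j<N. ennreal (cmod (poly p (z + \<omega> ^ j * w))))"
      by (simp add: sum_ennreal ennreal_leI)
    moreover have "indicator (ball 0 r) (\<omega> ^ j * w) = (indicator (ball 0 r) w :: ennreal)" for j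
      by (simp add: indicator_def norm_mult norm_power \<omega>_def)
    ultimately show "ennreal (of_nat N * cmod (poly p z)) * indicator (ball 0 r) w
        \<le> (\<Sum>j<N. F (\<omega> ^ j * w))"
      unfolding F_def by (auto simp: indicator_def)
  qed
  also have "\<dots> = of_nat N * (\<integral>\<^sup>+w. F w \<partial>lborel)"
    by (subst nn_integral_sum) (auto simp: F_rotate)
  finally have "ennreal (pi * r\<^sup>2) * ennreal (cmod (poly p z)) \<le> (\<integral>\<^sup>+w. F w \<partial>lborel)"
    using N0 by (subst (asm) ennreal_mult_le_mult_iff) auto
  also have "(\<integral>\<^sup>+w. F w \<partial>lborel) = (\<integral>\<^sup>+w. F w \<partial>distr lborel borel (\<lambda>w. - z + w))"
    unfolding lborel_distr_plus ..
  also have "\<dots> = (\<integral>\<^sup>+w. F (- z + w) \<partial>lborel)"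
    by (rule nn_integral_distr) auto
  also have "\<dots> = (\<integral>\<^sup>+w\<in>ball z r. ennreal (cmod (poly p w)) \<partial>lborel)"
    by (intro nn_integral_cong) (auto simp: F_def indicator_def dist_norm norm_minus_commute)
  finally show ?thesis .
qed

section \<open>The normalized area measure\<close>

lemma sets_disc_area: "sets disc_area = sets (lebesgue_on unit_disc)"
  by (simp add: disc_area_def)

lemma emeasure_lebesgue_unit_disc: "emeasure lebesgue unit_disc = ennreal pi"
  using emeasure_ball[of 1 "0::complex"] by (simp add: unit_ball_vol_2)

lemma prob_space_disc_area: "prob_space disc_area"
  unfolding disc_area_def
  by (rule prob_space_uniform_measure)
    (auto simp: emeasure_restrict_space emeasure_lebesgue_unit_disc)

interpretation disc_area: prob_space disc_area
  by (rule prob_space_disc_area)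

lemma borel_Int_disc_in_sets: "E \<in> sets borel \<Longrightarrow> E \<inter> unit_disc \<in> sets disc_area"
  by (auto simp: sets_disc_area sets_restrict_space image_iff intro!: bexI[of _ E])

lemma ball_subset_disc_in_sets [simp]:
  "ball x r \<subseteq> unit_disc \<Longrightarrow> ball x r \<in> sets disc_area"
  "ball x r \<inter> unit_disc \<in> sets disc_area"
  using borel_Int_disc_in_sets[of "ball x r"] by (auto simp: Int_absorb2)

lemma measure_disc_area_ball:
  assumes "ball x r \<subseteq> unit_disc" "0 \<le> r"
  shows "measure disc_area (ball x r) = r\<^sup>2"
proof -
  have "emeasure disc_area (ball x r) = ennreal (pi * r\<^sup>2) / ennreal pi"
    using assms by (subst emeasure_disc_area) (auto simp: emeasure_ball unit_ball_vol_2)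
  also have "\<dots> = ennreal (r\<^sup>2)"
    by (subst divide_ennreal) auto
  finally show ?thesis
    by (simp add: measure_def)
qed

text \<open>\<open>disc_area\<close> lives on the Lebesgue sigma-algebra of the disc, which contains
  the Borel one. The free \<open>M\<close> covers the densities \<open>\<mu>\<close> and
  \<open>\<kappa>\<close>, which share these sets.\<close>

lemma borel_measurable_disc_area:
  assumes "f \<in> borel_measurable borel" and "sets M = sets disc_area"
  shows "f \<in> borel_measurable M"
proof -
  have "f \<in> borel_measurable (lebesgue_on unit_disc)"
    using assms(1) by (intro measurable_restrict_space1 measurable_completion) simp
  then show ?thesis
    using assms(2) measurable_cong_sets sets_disc_area by blast
qed

lemma nn_integral_disc_area:
  assumes [measurable]: "f \<in> borel_measurable borel"
  shows "(\<integral>\<^sup>+z. f z \<partial>disc_area) = (\<integral>\<^sup>+z\<in>unit_disc. f z \<partial>lborel) / ennreal pi"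
proof -
  have [measurable]: "f \<in> borel_measurable (lebesgue_on unit_disc)"
    by (intro measurable_restrict_space1 measurable_completion) simp
  have "(\<integral>\<^sup>+z. f z \<partial>disc_area) =
      (\<integral>\<^sup>+z. f z * indicator unit_disc z \<partial>lebesgue_on unit_disc) / ennreal pi"
    unfolding disc_area_def
    by (subst nn_integral_uniform_measure)
      (auto simp: emeasure_restrict_space emeasure_lebesgue_unit_disc)
  also have "(\<integral>\<^sup>+z. f z * indicator unit_disc z \<partial>lebesgue_on unit_disc) =
      (\<integral>\<^sup>+z. f z * indicator unit_disc z \<partial>lebesgue)"
    by (subst nn_integral_restrict_space) (auto intro!: nn_integral_cong simp: indicator_def)
  also have "\<dots> = (\<integral>\<^sup>+z. f z * indicator unit_disc z \<partial>lborel)"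
    by (rule nn_integral_completion)
  finally show ?thesis .
qed

lemma poly_sub_mean_value_disc_area:
  fixes p :: "complex poly"
  assumes "0 < r" "ball z r \<subseteq> unit_disc"
  shows "ennreal (r\<^sup>2) * ennreal (cmod (poly p z)) \<le>
    (\<integral>\<^sup>+w\<in>ball z r. ennreal (cmod (poly p w)) \<partial>disc_area)"
proof -
  have [measurable]: "poly p \<in> borel_measurable borel"
    by (intro borel_measurable_continuous_onI continuous_intros)
  have "(\<integral>\<^sup>+w\<in>ball z r. ennreal (cmod (poly p w)) \<partial>disc_area) =
      (\<integral>\<^sup>+w\<in>ball z r. ennreal (cmod (poly p w)) \<partial>lborel) / ennreal pi"
    using assms(2)
    by (subst nn_integral_disc_area)
      (auto intro!: borel_measurable_times_ennreal arg_cong2[where f = divide] nn_integral_cong simp: indicator_def)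
  moreover have "ennreal (r\<^sup>2) * ennreal (cmod (poly p z)) =
      ennreal (pi * r\<^sup>2) * ennreal (cmod (poly p z)) / ennreal pi"
    by (simp add: divide_ennreal flip: ennreal_mult')
  ultimately show ?thesis
    using poly_sub_mean_value_ball[OF assms(1), of p z] by (simp add: divide_right_mono_ennreal)
qed

lemma ball_subset_unit_disc: "r \<le> 1 - cmod x \<Longrightarrow> ball x r \<subseteq> unit_disc"
  by (auto simp: dist_norm) (smt (verit) norm_triangle_sub norm_minus_commute)

section \<open>Pairs of measures with the Bekolle-Bonami property\<close>

text \<open>The estimates need the weight only through the two inequalities assumed here, with
  \<open>\<mu> = u dA\<close> and \<open>\<kappa> = (1/u) dA\<close> in mind. Carleson boxes are
  replaced by discs whose radius is at least the distance from the center to the unit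
  circle.\<close>

locale bekolle_pair = \<mu>: finite_measure \<mu> + \<kappa>: finite_measure \<kappa> for \<mu> \<kappa> :: "complex measure" +
  fixes C :: real
  assumes sets_\<mu>: "sets \<mu> = sets disc_area" and sets_\<kappa>: "sets \<kappa> = sets disc_area"
    and one_le_C: "1 \<le> C"
    and cauchy_schwarz: "\<And>E g. E \<in> sets disc_area \<Longrightarrow> g \<in> borel_measurable borel \<Longrightarrow>
      (\<integral>\<^sup>+z\<in>E. g z \<partial>disc_area)\<^sup>2 \<le> (\<integral>\<^sup>+z\<in>E. (g z)\<^sup>2 \<partial>\<mu>) * emeasure \<kappa> E"
    and bekolle: "\<And>w r. w \<in> unit_disc \<Longrightarrow> 1 - cmod w \<le> r \<Longrightarrow>
      measure \<mu> (ball w r \<inter> unit_disc) * measure \<kappa> (ball w r \<inter> unit_disc) \<le> C * r ^ 4"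
begin

lemma space_\<mu>: "space \<mu> = unit_disc" and space_\<kappa>: "space \<kappa> = unit_disc"
  using sets_\<mu> sets_\<kappa> sets_eq_imp_space_eq space_disc_area by metis+

text \<open>This is \<open>cauchy_schwarz\<close> with \<open>g = 1\<close>; the normalized area of
  the disc is \<open>r\<^sup>2\<close>.\<close>

lemma pow4_le_measure_ball:
  assumes "ball x r \<subseteq> unit_disc" "0 \<le> r"
  shows "r ^ 4 \<le> measure \<mu> (ball x r) * measure \<kappa> (ball x r)"
proof -
  have b: "ball x r \<in> sets disc_area" using assms by simp
  have "(emeasure disc_area (ball x r))\<^sup>2 \<le> emeasure \<mu> (ball x r) * emeasure \<kappa> (ball x r)"
    using cauchy_schwarz[OF b, of "\<lambda>_. 1"] b by (simp add: sets_\<mu>)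
  then have "ennreal ((r\<^sup>2)\<^sup>2) \<le> ennreal (measure \<mu> (ball x r) * measure \<kappa> (ball x r))"
    using assms
    by (simp add: \<mu>.emeasure_eq_measure \<kappa>.emeasure_eq_measure disc_area.emeasure_eq_measure
        measure_disc_area_ball ennreal_power ennreal_mult)
  then show ?thesis
    by (subst (asm) ennreal_le_iff) auto
qed

text \<open>In \<open>s^4 \<le> \<mu> b * \<kappa> b\<close> one factor is enlarged to its value on
  the big set. Multiplying by the other measure of the big set then produces the product that
  \<open>bekolle\<close> bounds. The argument is symmetric in the two measures.\<close>

lemma doubling:
  assumes "w \<in> unit_disc" "1 - cmod w \<le> r" "ball x s \<subseteq> ball w r \<inter> unit_disc" "0 < s"
  shows doubling_\<mu>: "measure \<mu> (ball w r \<inter> unit_disc) * s ^ 4 \<le> C * r ^ 4 * measure \<mu> (ball x s)"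
    and doubling_\<kappa>: "measure \<kappa> (ball w r \<inter> unit_disc) * s ^ 4 \<le> C * r ^ 4 * measure \<kappa> (ball x s)"
proof -
  let ?K = "ball w r \<inter> unit_disc" and ?b = "ball x s"
  have s: "s ^ 4 \<le> measure \<mu> ?b * measure \<kappa> ?b"
    using assms by (intro pow4_le_measure_ball) auto
  have le: "measure \<mu> ?b \<le> measure \<mu> ?K" "measure \<kappa> ?b \<le> measure \<kappa> ?K"
    using assms by (auto intro!: \<mu>.finite_measure_mono \<kappa>.finite_measure_mono simp: sets_\<mu> sets_\<kappa>)
  have B: "measure \<mu> ?K * measure \<kappa> ?K \<le> C * r ^ 4"
    using bekolle assms by blast
  have "measure \<mu> ?K * s ^ 4 \<le> measure \<mu> ?K * (measure \<mu> ?b * measure \<kappa> ?K)"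
    by (intro mult_left_mono order_trans[OF s] le) auto
  also have "\<dots> = (measure \<mu> ?K * measure \<kappa> ?K) * measure \<mu> ?b" by simp
  also have "\<dots> \<le> C * r ^ 4 * measure \<mu> ?b"
    by (intro mult_right_mono B) auto
  finally show "measure \<mu> ?K * s ^ 4 \<le> C * r ^ 4 * measure \<mu> ?b" .
  have "measure \<kappa> ?K * s ^ 4 \<le> measure \<kappa> ?K * (measure \<mu> ?K * measure \<kappa> ?b)"
    by (intro mult_left_mono mult_right_mono order_trans[OF s] le) auto
  also have "\<dots> = (measure \<mu> ?K * measure \<kappa> ?K) * measure \<kappa> ?b" by simp
  also have "\<dots> \<le> C * r ^ 4 * measure \<kappa> ?b"
    by (intro mult_right_mono B) auto
  finally show "measure \<kappa> ?K * s ^ 4 \<le> C * r ^ 4 * measure \<kappa> ?b" .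
qed

lemma measure_\<mu>_ball_pos:
  assumes "w \<in> unit_disc"
  shows "0 < measure \<mu> (ball w (1 - cmod w))"
proof -
  have "0 < (1 - cmod w) ^ 4" using assms by simp
  also have "\<dots> \<le> measure \<mu> (ball w (1 - cmod w)) * measure \<kappa> (ball w (1 - cmod w))"
    using assms by (intro pow4_le_measure_ball ball_subset_unit_disc) auto
  finally show ?thesis
    by (metis measure_nonneg mult_zero_left order_le_less order_less_irrefl)
qed

text \<open>The disc of radius \<open>2\<close> about \<open>a\<close> contains the whole unit disc,
  so this is an instance of doubling, with \<open>16 = 2^4\<close>.\<close>

lemma measure_\<mu>_disc_le:
  assumes "a \<in> unit_disc"
  shows "measure \<mu> unit_disc * (1 - cmod a) ^ 4 \<le> 16 * C * measure \<mu> (ball a (1 - cmod a))"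
proof -
  have eq: "ball a 2 \<inter> unit_disc = unit_disc"
    using assms by (auto simp: dist_norm) (smt (verit) norm_triangle_ineq4)
  have "measure \<mu> (ball a 2 \<inter> unit_disc) * (1 - cmod a) ^ 4 \<le> C * 2 ^ 4 * measure \<mu> (ball a (1 - cmod a))"
    using assms ball_subset_unit_disc[of "1 - cmod a" a] order_trans[of "-1" 0 "cmod a"]
    by (intro doubling_\<mu>) (simp_all add: eq)
  then show ?thesis by (simp add: eq)
qed

end

section \<open>Reverse doubling and decay over dyadic discs\<close>

text \<open>The center \<open>x\<close> is reached from \<open>a\<close> by moving
  \<open>3r/4\<close> towards the origin, possibly past it. Distances from \<open>a\<close> to
  points of the small disc lie between \<open>5r/8\<close> and \<open>7r/8\<close>; if the origin is
  passed, \<open>r \<le> 1\<close> keeps the small disc inside the unit disc.\<close>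

lemma exists_ball_in_half_annulus:
  assumes "a \<in> unit_disc" "0 < r" "r \<le> 1"
  obtains x where "ball x (r / 8) \<subseteq> ball a r \<inter> unit_disc" "ball x (r / 8) \<inter> ball a (r / 2) = {}"
proof -
  \<comment> \<open>Since \<open>sgn 0 = 0\<close> gives no direction, the unit vector
    \<open>1\<close> is taken at the origin.\<close>
  define e where "e = (if a = 0 then 1 else sgn a)"
  have e: "cmod e = 1" "a = of_real (cmod a) * e"
    by (auto simp: e_def sgn_eq norm_divide)
  define x where "x = a - of_real (3 / 4 * r) * e"
  have dist: "dist x a = 3 / 4 * r"
    using assms e(1) by (simp add: x_def dist_norm norm_mult)
  have "x = of_real (cmod a - 3 / 4 * r) * e"
    unfolding x_def by (subst e(2)) (simp add: algebra_simps)
  then have "cmod x = \<bar>cmod a - 3 / 4 * r\<bar>"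
    by (simp only: norm_mult e(1) norm_of_real mult_1_right)
  also have "\<dots> \<le> 1 - r / 8"
  proof -
    have "0 \<le> cmod a" "cmod a < 1" using assms by auto
    then show ?thesis using assms by (intro abs_leI; linarith)
  qed
  finally have norm_x: "cmod x \<le> 1 - r / 8" .
  show thesis
  proof
    show "ball x (r / 8) \<subseteq> ball a r \<inter> unit_disc"
    proof
      fix y assume y: "y \<in> ball x (r / 8)"
      then have "dist a y < r"
        using dist dist_triangle[of a y x] assms by (simp add: dist_commute)
      moreover have "y \<in> unit_disc"
        using ball_subset_unit_disc[of "r / 8" x] norm_x y by auto
      ultimately show "y \<in> ball a r \<inter> unit_disc" by simp
    qed
    have "y \<notin> ball a (r / 2)" if "y \<in> ball x (r / 8)" for y
      using that dist dist_triangle[of x a y] assms by (simp add: dist_commute)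
    then show "ball x (r / 8) \<inter> ball a (r / 2) = {}" by blast
  qed
qed

context bekolle_pair
begin

text \<open>
  The constant \<open>4096 = 8^4\<close> comes from the ball of radius \<open>r/8\<close> found in the half annulus.
\<close>
definition decay :: real where "decay = 1 - 1 / (4096 * C)"

lemma decay_bounds: "0 \<le> decay" "decay < 1"
  using one_le_C by (simp_all add: decay_def field_simps)

text \<open>The disc of radius \<open>r/8\<close> in the half annulus is disjoint from the half-size
  disc and, by doubling, carries at least the fraction \<open>1 / (4096 * C)\<close> of the mass of
  the large one.\<close>

lemma reverse_doubling:
  assumes "a \<in> unit_disc" "1 - cmod a \<le> r" "r \<le> 1"
  shows "measure \<kappa> (ball a (r / 2) \<inter> unit_disc) \<le> decay * measure \<kappa> (ball a r \<inter> unit_disc)"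
proof -
  have r: "0 < r" using assms by auto
  obtain x where x: "ball x (r / 8) \<subseteq> ball a r \<inter> unit_disc" "ball x (r / 8) \<inter> ball a (r / 2) = {}"
    using exists_ball_in_half_annulus[of a r] assms r by blast
  let ?K = "ball a r \<inter> unit_disc" and ?H = "ball a (r / 2) \<inter> unit_disc" and ?b = "ball x (r / 8)"
  have "measure \<kappa> ?K * (r / 8) ^ 4 \<le> C * r ^ 4 * measure \<kappa> ?b"
    using assms r x(1) by (intro doubling_\<kappa>) auto
  then have "measure \<kappa> ?K / (4096 * C) \<le> measure \<kappa> ?b"
    using r one_le_C by (simp add: power_divide field_simps)
  moreover have "measure \<kappa> ?H + measure \<kappa> ?b \<le> measure \<kappa> ?K"
  proof -
    have "measure \<kappa> ?H + measure \<kappa> ?b = measure \<kappa> (?H \<union> ?b)"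
      using x by (intro \<kappa>.finite_measure_Union[symmetric]) (auto simp: sets_\<kappa>)
    also have "\<dots> \<le> measure \<kappa> ?K"
      using x(1) r by (intro \<kappa>.finite_measure_mono) (auto simp: sets_\<kappa>)
    finally show ?thesis .
  qed
  ultimately show ?thesis
    by (simp add: decay_def algebra_simps)
qed

text \<open>The upper bound of \<open>bekolle\<close> at radius \<open>2 ^ k * h\<close> and the
  lower bound at radius \<open>h\<close> account for the factor \<open>16 ^ k\<close>. Comparing the
  two values of \<open>\<kappa>\<close> by \<open>k\<close> reverse doublings contributes
  \<open>decay ^ k\<close>.\<close>

lemma measure_\<mu>_dyadic:
  assumes a: "a \<in> unit_disc" and h: "h = 1 - cmod a" and k: "2 ^ k * h \<le> 1"
  shows "measure \<mu> (ball a (2 ^ k * h) \<inter> unit_disc) \<le> C * 16 ^ k * decay ^ k * measure \<mu> (ball a h)"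
proof -
  have h0: "0 < h" "h \<le> 1" using a h by auto
  have b: "ball a h \<subseteq> unit_disc" using ball_subset_unit_disc h by auto
  \<comment> \<open>Reverse doubling applies at every stage because the radii
    \<open>2 ^ j * h\<close> stay between \<open>h\<close> and \<open>1\<close>.\<close>
  have "measure \<kappa> (ball a h) \<le> decay ^ j * measure \<kappa> (ball a (2 ^ j * h) \<inter> unit_disc)" if "j \<le> k" for j
    using that
  proof (induction j)
    case 0
    then show ?case using b by (simp add: Int_absorb2)
  next
    case (Suc j)
    have "2 ^ Suc j * h \<le> 2 ^ k * h"
      using Suc.prems h0 by (intro mult_right_mono power_increasing) auto
    also note k
    finally have "2 ^ Suc j * h \<le> 1" .
    moreover have "1 * h \<le> 2 ^ Suc j * h"
      using h0 by (intro mult_right_mono) (auto simp: one_le_power simp del: power_Suc)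
    ultimately have "measure \<kappa> (ball a (2 ^ Suc j * h / 2) \<inter> unit_disc)
        \<le> decay * measure \<kappa> (ball a (2 ^ Suc j * h) \<inter> unit_disc)"
      using a h by (intro reverse_doubling) auto
    then have "decay ^ j * measure \<kappa> (ball a (2 ^ j * h) \<inter> unit_disc)
        \<le> decay ^ j * (decay * measure \<kappa> (ball a (2 ^ Suc j * h) \<inter> unit_disc))"
      using decay_bounds by (intro mult_left_mono) auto
    then show ?case
      using Suc by (simp add: mult_ac)
  qed
  from this[of k] have \<kappa>: "measure \<kappa> (ball a h) \<le> decay ^ k * measure \<kappa> (ball a (2 ^ k * h) \<inter> unit_disc)"
    by simp
  let ?K = "ball a (2 ^ k * h) \<inter> unit_disc"
  have "measure \<mu> ?K * h ^ 4 \<le> measure \<mu> ?K * (measure \<mu> (ball a h) * measure \<kappa> (ball a h))"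
    using h0 b by (intro mult_left_mono pow4_le_measure_ball) auto
  also have "\<dots> \<le> measure \<mu> ?K * (measure \<mu> (ball a h) * (decay ^ k * measure \<kappa> ?K))"
    by (intro mult_left_mono \<kappa>) auto
  also have "\<dots> = decay ^ k * measure \<mu> (ball a h) * (measure \<mu> ?K * measure \<kappa> ?K)"
    by simp
  also have "\<dots> \<le> decay ^ k * measure \<mu> (ball a h) * (C * (2 ^ k * h) ^ 4)"
  proof (intro mult_left_mono bekolle a)
    have "1 * h \<le> 2 ^ k * h" using h0 by (intro mult_right_mono) auto
    then show "1 - cmod a \<le> 2 ^ k * h" using h by simp
  qed (use decay_bounds in auto)
  also have "\<dots> = C * 16 ^ k * decay ^ k * measure \<mu> (ball a h) * h ^ 4"
  proof -
    have "(2 ^ k * h) ^ 4 = 16 ^ k * h ^ 4"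
      by (simp add: power_mult_distrib flip: power_mult) (simp add: power_mult mult.commute[of k])
    then show ?thesis by simp
  qed
  finally show ?thesis
    using h0 by simp
qed

end

section \<open>Norms of Bergman kernels\<close>

text \<open>The first two bounds limit the kernel from above, near \<open>a\<close> and away from
  \<open>a\<close>; the third keeps it large on the disc of radius \<open>1 - cmod a\<close> about
  \<open>a\<close>.\<close>

lemma bergman_denominator_bounds:
  assumes "a \<in> unit_disc" "z \<in> unit_disc"
  shows "1 - cmod a \<le> cmod (1 - cnj a * z)"
    and "cmod (z - a) \<le> cmod (1 - cnj a * z)"
    and "cmod (1 - cnj a * z) \<le> 2 * (1 - cmod a) + cmod (z - a)"
proof -
  have a: "cmod a < 1" "cmod z < 1" using assms by auto
  have "cmod (cnj a * z) \<le> cmod a * 1"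
    unfolding norm_mult complex_mod_cnj using a by (intro mult_left_mono) auto
  then show "1 - cmod a \<le> cmod (1 - cnj a * z)"
    using norm_triangle_ineq2[of 1 "cnj a * z"] by simp
  \<comment> \<open>This is the identity behind the pseudohyperbolic distance
    \<open>|z - a| / |1 - cnj a * z|\<close>; its right side is nonnegative in the disc.\<close>
  have "(cmod (1 - cnj a * z))\<^sup>2 - (cmod (z - a))\<^sup>2 = (1 - (cmod a)\<^sup>2) * (1 - (cmod z)\<^sup>2)"
    unfolding cmod_power2 by (simp add: power2_eq_square algebra_simps)
  moreover have "0 \<le> (1 - (cmod a)\<^sup>2) * (1 - (cmod z)\<^sup>2)"
    using a by (intro mult_nonneg_nonneg) (simp_all add: power_le_one)
  ultimately have "(cmod (z - a))\<^sup>2 \<le> (cmod (1 - cnj a * z))\<^sup>2"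
    by linarith
  then show "cmod (z - a) \<le> cmod (1 - cnj a * z)"
    by (rule power2_le_imp_le) simp
  \<comment> \<open>Expansion around \<open>z = a\<close>, where the denominator equals
    \<open>1 - |a|^2\<close>.\<close>
  have "1 - cnj a * z = of_real (1 - (cmod a)\<^sup>2) - cnj a * (z - a)"
    unfolding of_real_diff complex_norm_square by (simp add: algebra_simps)
  then have "cmod (1 - cnj a * z) \<le> cmod (of_real (1 - (cmod a)\<^sup>2)) + cmod (cnj a * (z - a))"
    by (simp only: norm_triangle_ineq4)
  also have "\<dots> = \<bar>1 - (cmod a)\<^sup>2\<bar> + cmod a * cmod (z - a)"
    by (simp only: norm_mult complex_mod_cnj norm_of_real)
  also have "\<bar>1 - (cmod a)\<^sup>2\<bar> = (1 - cmod a) * (1 + cmod a)"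
    using a by (simp add: power_le_one) (simp add: power2_eq_square algebra_simps)
  also have "(1 - cmod a) * (1 + cmod a) + cmod a * cmod (z - a) \<le>
      (1 - cmod a) * 2 + 1 * cmod (z - a)"
    using a by (intro add_mono mult_left_mono mult_right_mono) auto
  finally show "cmod (1 - cnj a * z) \<le> 2 * (1 - cmod a) + cmod (z - a)"
    by simp
qed

lemma norm_bergman_kernel: "(cmod (bergman_kernel a z))\<^sup>2 = 1 / cmod (1 - cnj a * z) ^ 4"
  by (simp add: bergman_kernel_def norm_divide norm_power power_divide flip: power_mult)

lemma bergman_kernel_le:
  assumes "0 < d" "d \<le> cmod (1 - cnj a * z)"
  shows "(cmod (bergman_kernel a z))\<^sup>2 \<le> 1 / d ^ 4"
  unfolding norm_bergman_kernel using assms by (intro divide_left_mono power_mono mult_pos_pos) auto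

lemma borel_measurable_bergman_kernel [measurable]: "bergman_kernel a \<in> borel_measurable borel"
  unfolding bergman_kernel_def by measurable

context bekolle_pair
begin

lemma measurable_\<mu>: "f \<in> borel_measurable borel \<Longrightarrow> f \<in> borel_measurable \<mu>"
  using borel_measurable_disc_area sets_\<mu> by blast

text \<open>On the ring between the radii \<open>2^k h\<close> and \<open>2^(k+1) h\<close> the
  squared kernel is at most \<open>1 / (2^k h)^4\<close>, and \<open>measure_\<mu>_dyadic\<close>
  bounds the mass. The powers of \<open>16\<close> cancel up to a single factor, and the powers of
  \<open>decay\<close> remain as a geometric sum.\<close>

lemma nn_integral_bergman_kernel_dyadic:
  assumes a: "a \<in> unit_disc" and h: "h = 1 - cmod a" and k: "2 ^ k * h \<le> 1"
  shows "(\<integral>\<^sup>+z\<in>ball a (2 ^ k * h) \<inter> unit_disc. ennreal ((cmod (bergman_kernel a z))\<^sup>2) \<partial>\<mu>)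
    \<le> ennreal (16 * C * (\<Sum>j\<le>k. decay ^ j) * (measure \<mu> (ball a h) / h ^ 4))"
  using k
proof (induction k)
  case 0
  have h0: "0 < h" using a h by auto
  have b: "ball a h \<subseteq> unit_disc" using ball_subset_unit_disc h by auto
  have "(\<integral>\<^sup>+z\<in>ball a h. ennreal ((cmod (bergman_kernel a z))\<^sup>2) \<partial>\<mu>)
      \<le> (\<integral>\<^sup>+z\<in>ball a h. ennreal (1 / h ^ 4) \<partial>\<mu>)"
    using bergman_denominator_bounds(1)[OF a] h h0 b
    by (intro nn_integral_mono) (auto intro!: mult_right_mono ennreal_leI bergman_kernel_le simp: indicator_def)
  also have "\<dots> = ennreal (1 / h ^ 4 * measure \<mu> (ball a h))"
    using b h0
    by (subst nn_integral_cmult_indicator)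
      (simp_all add: sets_\<mu> \<mu>.emeasure_eq_measure flip: ennreal_mult')
  also have "\<dots> \<le> ennreal (16 * C * (measure \<mu> (ball a h) / h ^ 4))"
    using one_le_C mult_right_mono[of 1 "16 * C" "measure \<mu> (ball a h) / h ^ 4"] h0
    by (intro ennreal_leI) simp
  finally show ?case using b by (simp add: Int_absorb2)
next
  case (Suc k)
  define B where "B z = ennreal ((cmod (bergman_kernel a z))\<^sup>2)" for z
  define K where "K j = ball a (2 ^ j * h) \<inter> unit_disc" for j :: nat
  define m where "m = measure \<mu> (ball a h) / h ^ 4"
  \<comment> \<open>This equals \<open>1 / (2 ^ k * h) ^ 4\<close>, the kernel bound from the inner
    radius, but is written with the outer radius, at which the mass is estimated.\<close>
  define d where "d = 16 / (2 ^ Suc k * h) ^ 4"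
  have h0: "0 < h" using a h by auto
  have d0: "0 \<le> d" and m0: "0 \<le> m" using h0 by (simp_all add: d_def m_def)
  have B_meas [measurable]: "B \<in> borel_measurable \<mu>"
    unfolding B_def by (intro measurable_\<mu>) measurable
  have K_sets [measurable]: "K j \<in> sets \<mu>" for j by (simp add: sets_\<mu> K_def)
  have far: "B z \<le> ennreal d" if z: "z \<in> K (Suc k)" "z \<notin> K k" for z
  proof -
    have "2 ^ k * h \<le> cmod (1 - cnj a * z)"
      using bergman_denominator_bounds(2)[OF a, of z] z by (auto simp: K_def dist_norm norm_minus_commute)
    then have "(cmod (bergman_kernel a z))\<^sup>2 \<le> 1 / (2 ^ k * h) ^ 4"
      using h0 by (intro bergman_kernel_le) auto
    also have "\<dots> = d" by (simp add: power_mult_distrib d_def)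
    finally show ?thesis unfolding B_def by (rule ennreal_leI)
  qed
  have step: "ennreal d * emeasure \<mu> (K (Suc k)) \<le> ennreal (16 * C * decay ^ Suc k * m)"
  proof -
    have pow: "(2 ^ Suc k * h) ^ 4 = 16 ^ Suc k * h ^ 4"
    proof -
      have "((2::real) ^ Suc k) ^ 4 = (2 ^ 4) ^ Suc k" by (metis power_mult mult.commute)
      then show ?thesis by (simp add: power_mult_distrib del: power_Suc)
    qed
    have "d * measure \<mu> (K (Suc k)) \<le> d * (C * 16 ^ Suc k * decay ^ Suc k * measure \<mu> (ball a h))"
      unfolding K_def by (intro mult_left_mono measure_\<mu>_dyadic a h Suc.prems d0)
    also have "\<dots> = 16 * C * decay ^ Suc k * m"
      unfolding d_def m_def pow using h0 by simp
    finally have "ennreal (d * measure \<mu> (K (Suc k))) \<le> ennreal (16 * C * decay ^ Suc k * m)"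
      by (rule ennreal_leI)
    then show ?thesis
      using d0 by (simp only: \<mu>.emeasure_eq_measure ennreal_mult measure_nonneg)
  qed
  have IH: "(\<integral>\<^sup>+z\<in>K k. B z \<partial>\<mu>) \<le> ennreal (16 * C * (\<Sum>j\<le>k. decay ^ j) * m)"
    unfolding B_def K_def m_def using Suc.prems h0 by (intro Suc.IH) simp
  have "(\<integral>\<^sup>+z\<in>K (Suc k). B z \<partial>\<mu>) \<le>
      (\<integral>\<^sup>+z. B z * indicator (K k) z + ennreal d * indicator (K (Suc k)) z \<partial>\<mu>)"
    using far by (intro nn_integral_mono) (auto simp: indicator_def)
  also have "\<dots> = (\<integral>\<^sup>+z\<in>K k. B z \<partial>\<mu>) + ennreal d * emeasure \<mu> (K (Suc k))"
    by (subst nn_integral_add) (auto simp: nn_integral_cmult_indicator)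
  also have "\<dots> \<le> ennreal (16 * C * (\<Sum>j\<le>k. decay ^ j) * m) + ennreal (16 * C * decay ^ Suc k * m)"
    by (rule add_mono[OF IH step])
  also have "\<dots> = ennreal (16 * C * (\<Sum>j\<le>k. decay ^ j) * m + 16 * C * decay ^ Suc k * m)"
    using one_le_C decay_bounds m0
    by (intro ennreal_plus[symmetric] mult_nonneg_nonneg sum_nonneg zero_le_power) auto
  also have "16 * C * (\<Sum>j\<le>k. decay ^ j) * m + 16 * C * decay ^ Suc k * m =
      16 * C * (\<Sum>j\<le>Suc k. decay ^ j) * m"
    by (simp add: algebra_simps)
  finally show ?case unfolding B_def K_def m_def .
qed

text \<open>The first summand bounds the geometric sum over the dyadic discs. The second comes from
  the rest of the unit disc, where the squared kernel is at most \<open>16\<close> and the mass is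
  bounded by \<open>measure_\<mu>_disc_le\<close>.\<close>

definition kernel_bound :: real where "kernel_bound = 16 * C / (1 - decay) + 16 * (16 * C)"

lemma kernel_bound_nonneg: "0 \<le> kernel_bound"
  using one_le_C decay_bounds by (simp add: kernel_bound_def)

lemma nn_integral_bergman_kernel_le:
  assumes a: "a \<in> unit_disc" and h: "h = 1 - cmod a"
  shows "(\<integral>\<^sup>+z. ennreal ((cmod (bergman_kernel a z))\<^sup>2) \<partial>\<mu>)
    \<le> ennreal (kernel_bound * (measure \<mu> (ball a h) / h ^ 4))"
proof -
  have h0: "0 < h" "h \<le> 1" using a h by auto
  let ?B = "\<lambda>z. ennreal ((cmod (bergman_kernel a z))\<^sup>2)"
  let ?m = "measure \<mu> (ball a h) / h ^ 4"
  have [measurable]: "bergman_kernel a \<in> borel_measurable \<mu>"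
    by (intro measurable_\<mu> borel_measurable_bergman_kernel)
  \<comment> \<open>The last dyadic disc of radius at most \<open>1\<close>. Its radius exceeds
    \<open>1/2\<close>, so \<open>|1 - cnj a * z| \<ge> 1/2\<close> outside it. The exponent
    \<open>b\<close> bounds the candidates, so that the maximum exists.\<close>
  define k where "k = (GREATEST k. 2 ^ k * h \<le> 1)"
  obtain b :: nat where b: "1 / h < 2 ^ b" using real_arch_pow[of 2 "1 / h"] by auto
  have bd: "j \<le> b" if "2 ^ j * h \<le> 1" for j :: nat
  proof (rule ccontr)
    assume "\<not> j \<le> b"
    then have "2 ^ b * h \<le> 2 ^ j * h"
      using h0 by (intro mult_right_mono power_increasing) auto
    moreover have "1 < 2 ^ b * h" using b h0 by (simp add: field_simps)
    ultimately show False using that by linarith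
  qed
  have k: "2 ^ k * h \<le> 1"
    unfolding k_def by (rule GreatestI_nat[of _ 0 b]) (use h0 bd in auto)
  have "\<not> 2 ^ Suc k * h \<le> 1"
    using Greatest_le_nat[of "\<lambda>k. 2 ^ k * h \<le> 1" "Suc k" b] bd unfolding k_def by fastforce
  then have k': "1 / 2 < 2 ^ k * h" by simp
  let ?K = "ball a (2 ^ k * h) \<inter> unit_disc"
  have [measurable]: "?K \<in> sets \<mu>" by (simp add: sets_\<mu>)
  have near: "(\<integral>\<^sup>+z\<in>?K. ?B z \<partial>\<mu>) \<le> ennreal (16 * C / (1 - decay) * ?m)"
  proof (rule order_trans[OF nn_integral_bergman_kernel_dyadic[OF a h k]], intro ennreal_leI mult_right_mono)
    have "(\<Sum>j\<le>k. decay ^ j) = (1 - decay ^ Suc k) / (1 - decay)"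
      using decay_bounds by (simp add: sum_gp0)
    also have "\<dots> \<le> 1 / (1 - decay)"
      using decay_bounds by (intro divide_right_mono) auto
    finally have "16 * C * (\<Sum>j\<le>k. decay ^ j) \<le> 16 * C * (1 / (1 - decay))"
      using one_le_C by (intro mult_left_mono) auto
    then show "16 * C * (\<Sum>j\<le>k. decay ^ j) \<le> 16 * C / (1 - decay)" by simp
  qed (use h0 in simp)
  have far: "ennreal 16 * emeasure \<mu> unit_disc \<le> ennreal (16 * (16 * C) * ?m)"
  proof -
    have "16 * measure \<mu> unit_disc \<le> 16 * (16 * C) * ?m"
      using measure_\<mu>_disc_le[OF a] h0 by (simp add: h[symmetric] field_simps)
    then have "ennreal (16 * measure \<mu> unit_disc) \<le> ennreal (16 * (16 * C) * ?m)"
      by (rule ennreal_leI)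
    then show ?thesis
      by (simp only: \<mu>.emeasure_eq_measure ennreal_mult measure_nonneg zero_le_numeral)
  qed
  have "(\<integral>\<^sup>+z. ?B z \<partial>\<mu>) \<le> (\<integral>\<^sup>+z. ?B z * indicator ?K z + ennreal 16 \<partial>\<mu>)"
  proof (rule nn_integral_mono)
    fix z assume "z \<in> space \<mu>"
    then have z: "z \<in> unit_disc" by (simp add: space_\<mu>)
    show "?B z \<le> ?B z * indicator ?K z + ennreal 16"
    proof (cases "z \<in> ?K")
      case False
      then have "1 / 2 \<le> cmod (1 - cnj a * z)"
        using bergman_denominator_bounds(2)[OF a z] z k' by (auto simp: dist_norm norm_minus_commute)
      then have "(cmod (bergman_kernel a z))\<^sup>2 \<le> 1 / (1 / 2) ^ 4"
        by (intro bergman_kernel_le) auto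
      then have "?B z \<le> ennreal 16" by (intro ennreal_leI) (simp add: power_divide)
      then show ?thesis using False by simp
    qed simp
  qed
  also have "\<dots> = (\<integral>\<^sup>+z\<in>?K. ?B z \<partial>\<mu>) + ennreal 16 * emeasure \<mu> unit_disc"
    by (subst nn_integral_add) (auto simp: space_\<mu>)
  also have "\<dots> \<le> ennreal (16 * C / (1 - decay) * ?m) + ennreal (16 * (16 * C) * ?m)"
    by (rule add_mono[OF near far])
  also have "\<dots> = ennreal (kernel_bound * ?m)"
    unfolding kernel_bound_def distrib_right
    using one_le_C decay_bounds h0 by (intro ennreal_plus[symmetric]) auto
  finally show ?thesis .
qed

section \<open>From bounds on discs to the Carleson inequality\<close>

text \<open>The sub-mean value property on radius \<open>h/2\<close> is squared, and
  \<open>cauchy_schwarz\<close> trades area for \<open>\<mu>\<close> at the cost of a factor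
  \<open>\<kappa>\<close>. After multiplication by the \<open>\<mu>\<close>-mass of the disc of
  radius \<open>h\<close>, \<open>bekolle\<close> turns the two masses into
  \<open>C * h ^ 4\<close>, which cancels against the squared area
  \<open>h ^ 4 / 16\<close>.\<close>

lemma poly_le_local_integral:
  fixes p :: "complex poly"
  assumes z: "z \<in> unit_disc" and h: "h = 1 - cmod z"
  shows "ennreal (measure \<mu> (ball z h)) * ennreal ((cmod (poly p z))\<^sup>2)
    \<le> ennreal (16 * C) * (\<integral>\<^sup>+w\<in>ball z (h / 2). ennreal ((cmod (poly p w))\<^sup>2) \<partial>\<mu>)"
    (is "_ \<le> _ * ?I")
proof -
  have h0: "0 < h" using z h by auto
  have sub: "ball z (h / 2) \<subseteq> ball z h" using h0 by auto
  have b: "ball z h \<subseteq> unit_disc" using ball_subset_unit_disc h by auto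
  have [measurable]: "poly p \<in> borel_measurable borel"
    by (intro borel_measurable_continuous_onI continuous_intros)
  have "(ennreal ((h / 2)\<^sup>2) * ennreal (cmod (poly p z)))\<^sup>2
      \<le> (\<integral>\<^sup>+w\<in>ball z (h / 2). ennreal (cmod (poly p w)) \<partial>disc_area)\<^sup>2"
    using sub b h0 by (intro power_mono poly_sub_mean_value_disc_area) auto
  also have "\<dots> \<le> (\<integral>\<^sup>+w\<in>ball z (h / 2). (ennreal (cmod (poly p w)))\<^sup>2 \<partial>\<mu>) * emeasure \<kappa> (ball z (h / 2))"
    using sub b by (intro cauchy_schwarz) auto
  also have "\<dots> = ?I * emeasure \<kappa> (ball z (h / 2))"
    by (simp add: ennreal_power)
  also have "\<dots> \<le> ?I * ennreal (measure \<kappa> (ball z h))"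
    using sub b unfolding \<kappa>.emeasure_eq_measure[symmetric]
    by (intro mult_left_mono emeasure_mono) (auto simp: sets_\<kappa>)
  finally have 1: "ennreal (h ^ 4 / 16 * (cmod (poly p z))\<^sup>2) \<le> ?I * ennreal (measure \<kappa> (ball z h))"
    by (simp add: ennreal_power power_mult_distrib power_divide flip: ennreal_mult' power_mult)
  have "ennreal (h ^ 4 / 16) * (ennreal (measure \<mu> (ball z h)) * ennreal ((cmod (poly p z))\<^sup>2)) =
      ennreal (measure \<mu> (ball z h)) * ennreal (h ^ 4 / 16 * (cmod (poly p z))\<^sup>2)"
  proof -
    have "ennreal (h ^ 4 / 16 * (cmod (poly p z))\<^sup>2) = ennreal (h ^ 4 / 16) * ennreal ((cmod (poly p z))\<^sup>2)"
      using h0 by (intro ennreal_mult) auto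
    then show ?thesis by (simp only: mult.left_commute)
  qed
  also have "\<dots> \<le> ennreal (measure \<mu> (ball z h)) * (?I * ennreal (measure \<kappa> (ball z h)))"
    by (intro mult_left_mono 1) auto
  also have "\<dots> = ?I * ennreal (measure \<mu> (ball z h) * measure \<kappa> (ball z h))"
    by (simp add: ennreal_mult mult_ac)
  also have "\<dots> \<le> ?I * ennreal (C * h ^ 4)"
    using bekolle[OF z, of h] h b by (intro mult_left_mono ennreal_leI) (auto simp: Int_absorb2)
  also have "\<dots> = ennreal (h ^ 4 / 16) * (ennreal (16 * C) * ?I)"
  proof -
    have "ennreal (C * h ^ 4) = ennreal (h ^ 4 / 16) * ennreal (16 * C)"
      using h0 one_le_C by (simp flip: ennreal_mult')
    then show ?thesis by (simp add: mult_ac)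
  qed
  finally show ?thesis
    using h0 by (subst (asm) ennreal_mult_le_mult_iff) (auto simp: ennreal_eq_0_iff)
qed

text \<open>With \<open>h = 1 - cmod z\<close>, the bounds \<open>1 - cmod w \<le> 3h/2\<close> and
  \<open>dist z w < h/2\<close> put the disc about \<open>w\<close> inside the disc of radius
  \<open>2h\<close> about \<open>z\<close>, and doubling gives \<open>16 = 2^4\<close>.\<close>

lemma measure_\<mu>_ball_comparable:
  assumes z: "z \<in> unit_disc" and w: "dist z w < (1 - cmod z) / 2"
  shows "measure \<mu> (ball w (1 - cmod w)) \<le> 16 * C * measure \<mu> (ball z (1 - cmod z))"
proof -
  define h where "h = 1 - cmod z"
  have h0: "0 < h" using z by (simp add: h_def)
  have "cmod z \<le> cmod w + dist z w" by (metis dist_norm norm_triangle_sub add.commute)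
  then have "1 - cmod w \<le> 3 / 2 * h" using w by (simp add: h_def)
  then have "ball w (1 - cmod w) \<subseteq> ball z (2 * h) \<inter> unit_disc"
    using w dist_triangle[of z _ w] ball_subset_unit_disc[of "1 - cmod w" w]
    by (auto simp: h_def) (smt (verit) field_sum_of_halves)
  then have "measure \<mu> (ball w (1 - cmod w)) \<le> measure \<mu> (ball z (2 * h) \<inter> unit_disc)"
    by (intro \<mu>.finite_measure_mono) (auto simp: sets_\<mu>)
  moreover have "measure \<mu> (ball z (2 * h) \<inter> unit_disc) * h ^ 4 \<le> C * (2 * h) ^ 4 * measure \<mu> (ball z h)"
    using z h0 ball_subset_unit_disc[of h z] by (intro doubling_\<mu>) (auto simp: h_def)
  then have "measure \<mu> (ball z (2 * h) \<inter> unit_disc) * h ^ 4 \<le> 16 * C * measure \<mu> (ball z h) * h ^ 4"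
    by (simp add: power_mult_distrib mult_ac)
  ultimately show ?thesis
    using h0 by (simp add: h_def)
qed

text \<open>Tonelli's theorem is applied to a function \<open>F\<close> whose integral in
  \<open>w\<close> dominates \<open>|p z|^2\<close> up to a constant and whose integral in
  \<open>z\<close> is controlled by the hypothesis on discs.\<close>

lemma carleson_of_ball_bound:
  fixes p :: "complex poly"
  assumes \<nu>: "finite_measure \<nu>" "sets \<nu> = sets (restrict_space borel unit_disc)"
    and M: "0 \<le> M" "\<And>w. w \<in> unit_disc \<Longrightarrow>
      measure \<nu> (ball w (1 - cmod w)) \<le> M * measure \<mu> (ball w (1 - cmod w))"
  shows "(\<integral>\<^sup>+z. ennreal ((cmod (poly p z))\<^sup>2) \<partial>\<nu>)
    \<le> ennreal ((16 * C)\<^sup>2 * M) * (\<integral>\<^sup>+w. ennreal ((cmod (poly p w))\<^sup>2) \<partial>\<mu>)"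
proof -
  interpret \<nu>: finite_measure \<nu> by fact
  interpret P: pair_sigma_finite \<nu> \<mu> ..
  have space_\<nu>: "space \<nu> = unit_disc"
    using sets_eq_imp_space_eq[OF \<nu>(2)] by (simp add: space_restrict_space)
  let ?\<beta> = "\<lambda>w. ball w (1 - cmod w)"
  define m where "m w = measure \<mu> (?\<beta> w)" for w
  have measurable_\<nu>: "f \<in> borel_measurable \<nu>" if "f \<in> borel_measurable borel" for f :: "complex \<Rightarrow> 'z::topological_space"
    using measurable_restrict_space1[OF that] measurable_cong_sets[OF \<nu>(2) refl] by blast
  have p_borel: "poly p \<in> borel_measurable borel"
    by (intro borel_measurable_continuous_onI continuous_intros)
  have [measurable]: "poly p \<in> borel_measurable \<mu>" "poly p \<in> borel_measurable \<nu>"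
    using p_borel by (auto intro: measurable_\<mu> measurable_\<nu>)
  have dist_meas: "(\<lambda>x. dist (fst x) (snd x)) \<in> borel_measurable (N \<Otimes>\<^sub>M \<mu>)"
    "(\<lambda>x. cmod (fst x)) \<in> borel_measurable (N \<Otimes>\<^sub>M \<mu>)"
    if N: "(\<lambda>z. z) \<in> borel_measurable N" for N :: "complex measure"
  proof -
    have "fst \<in> borel_measurable (N \<Otimes>\<^sub>M \<mu>)" "snd \<in> borel_measurable (N \<Otimes>\<^sub>M \<mu>)"
      using measurable_compose[OF measurable_fst N, of \<mu>]
        measurable_compose[OF measurable_snd measurable_\<mu>[of "\<lambda>z. z"], of N] by simp_all
    then show "(\<lambda>x. dist (fst x) (snd x)) \<in> borel_measurable (N \<Otimes>\<^sub>M \<mu>)"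
        "(\<lambda>x. cmod (fst x)) \<in> borel_measurable (N \<Otimes>\<^sub>M \<mu>)"
      by (auto intro: borel_measurable_dist measurable_compose[OF _ borel_measurable_norm])
  qed
  \<comment> \<open>The discs are the sections of one measurable set in the product, so their masses
    depend measurably on the center.\<close>
  have m_meas [measurable]: "m \<in> borel_measurable \<mu>"
  proof -
    have "(\<lambda>w. emeasure \<mu> (?\<beta> w)) \<in> borel_measurable \<mu>"
    proof (rule \<mu>.measurable_emeasure)
      fix w assume "w \<in> space \<mu>"
      show "?\<beta> w \<subseteq> space \<mu>" using ball_subset_unit_disc by (simp add: space_\<mu>)
    next
      have "(\<lambda>x. 1 - cmod (fst x)) \<in> borel_measurable (\<mu> \<Otimes>\<^sub>M \<mu>)"
        by (intro borel_measurable_diff borel_measurable_const dist_meas(2) measurable_\<mu>) simp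
      with dist_meas(1)[OF measurable_\<mu>]
      have "{x \<in> space (\<mu> \<Otimes>\<^sub>M \<mu>). dist (fst x) (snd x) < 1 - cmod (fst x)} \<in> sets (\<mu> \<Otimes>\<^sub>M \<mu>)"
        by (intro borel_measurable_less) simp_all
      then show "{x \<in> space (\<mu> \<Otimes>\<^sub>M \<mu>). snd x \<in> ?\<beta> (fst x)} \<in> sets (\<mu> \<Otimes>\<^sub>M \<mu>)"
        by simp
    qed
    then show ?thesis unfolding m_def measure_def by measurable
  qed
  \<comment> \<open>The weight is \<open>1 / m w\<close> and not \<open>1 / m z\<close>, so that
    integrating in \<open>z\<close> leaves at most the ratio of the \<open>\<nu>\<close>- and
    \<open>\<mu>\<close>-masses of the disc about \<open>w\<close>, which \<open>M\<close>
    bounds.\<close>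
  define F where "F z w = (if dist z w < (1 - cmod z) / 2
    then ennreal ((cmod (poly p w))\<^sup>2) * ennreal (1 / m w) else 0)" for z w
  have F_meas [measurable]: "case_prod F \<in> borel_measurable (\<nu> \<Otimes>\<^sub>M \<mu>)"
  proof -
    note [measurable] = dist_meas[OF measurable_\<nu>, simplified]
    show ?thesis unfolding F_def case_prod_beta' by measurable
  qed
  \<comment> \<open>One factor \<open>16 * C\<close> comes from the local estimate, the other from
    exchanging \<open>m z\<close> for \<open>m w\<close>.\<close>
  have pt: "ennreal ((cmod (poly p z))\<^sup>2) \<le> ennreal ((16 * C)\<^sup>2) * (\<integral>\<^sup>+w. F z w \<partial>\<mu>)"
    if z: "z \<in> unit_disc" for z
  proof -
    have mz: "0 < m z" unfolding m_def using measure_\<mu>_ball_pos z by simp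
    let ?I = "\<integral>\<^sup>+w\<in>ball z ((1 - cmod z) / 2). ennreal ((cmod (poly p w))\<^sup>2) \<partial>\<mu>"
    have [measurable]: "ball z ((1 - cmod z) / 2) \<in> sets \<mu>"
      using z ball_subset_unit_disc[of "(1 - cmod z) / 2" z] by (simp add: sets_\<mu>)
    have "ennreal ((cmod (poly p z))\<^sup>2) = ennreal (1 / m z) * (ennreal (m z) * ennreal ((cmod (poly p z))\<^sup>2))"
      using mz by (simp flip: ennreal_mult')
    also have "\<dots> \<le> ennreal (1 / m z) * (ennreal (16 * C) * ?I)"
      unfolding m_def by (intro mult_left_mono poly_le_local_integral z) auto
    also have "\<dots> = ennreal (16 * C) *
        (\<integral>\<^sup>+w\<in>ball z ((1 - cmod z) / 2). ennreal (1 / m z) * ennreal ((cmod (poly p w))\<^sup>2) \<partial>\<mu>)"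
      by (simp add: mult.assoc nn_integral_cmult mult.left_commute)
    also have "\<dots> \<le> ennreal (16 * C) * (\<integral>\<^sup>+w. ennreal (16 * C) * F z w \<partial>\<mu>)"
    proof (intro mult_left_mono nn_integral_mono)
      fix w assume "w \<in> space \<mu>"
      then have w: "w \<in> unit_disc" by (simp add: space_\<mu>)
      show "ennreal (1 / m z) * ennreal ((cmod (poly p w))\<^sup>2) * indicator (ball z ((1 - cmod z) / 2)) w
          \<le> ennreal (16 * C) * F z w"
      proof (cases "dist z w < (1 - cmod z) / 2")
        case True
        have mw: "0 < m w" unfolding m_def using measure_\<mu>_ball_pos w by simp
        have "m w \<le> 16 * C * m z" unfolding m_def by (rule measure_\<mu>_ball_comparable[OF z True])
        then have "1 / m z \<le> 16 * C * (1 / m w)" using mz mw by (simp add: field_simps)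
        then have "ennreal (1 / m z) \<le> ennreal (16 * C) * ennreal (1 / m w)"
          using one_le_C mw by (simp add: ennreal_leI flip: ennreal_mult)
        then have "ennreal (1 / m z) * ennreal ((cmod (poly p w))\<^sup>2) \<le>
            ennreal (16 * C) * ennreal (1 / m w) * ennreal ((cmod (poly p w))\<^sup>2)"
          by (rule mult_right_mono) simp
        then show ?thesis using True by (simp add: F_def mult_ac)
      qed simp
    qed simp
    also have "\<dots> = ennreal ((16 * C)\<^sup>2) * (\<integral>\<^sup>+w. F z w \<partial>\<mu>)"
    proof -
      have [measurable]: "F z \<in> borel_measurable \<mu>"
        using measurable_Pair2[OF F_meas, of z] z by (simp add: space_\<nu>)
      have "ennreal ((16 * C)\<^sup>2) = ennreal (16 * C) * ennreal (16 * C)"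
        unfolding power2_eq_square using one_le_C by (intro ennreal_mult) auto
      then show ?thesis
        by (simp only: mult.assoc) (subst nn_integral_cmult, measurable)
    qed
    finally show ?thesis .
  qed
  have integral_F: "(\<integral>\<^sup>+z. (\<integral>\<^sup>+w. F z w \<partial>\<mu>) \<partial>\<nu>) \<le> ennreal M * (\<integral>\<^sup>+w. ennreal ((cmod (poly p w))\<^sup>2) \<partial>\<mu>)"
  proof -
    have "(\<integral>\<^sup>+z. (\<integral>\<^sup>+w. F z w \<partial>\<mu>) \<partial>\<nu>) = (\<integral>\<^sup>+w. (\<integral>\<^sup>+z. F z w \<partial>\<nu>) \<partial>\<mu>)"
      by (rule P.Fubini'[symmetric]) measurable
    also have "\<dots> \<le> (\<integral>\<^sup>+w. ennreal M * ennreal ((cmod (poly p w))\<^sup>2) \<partial>\<mu>)"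
    proof (rule nn_integral_mono)
      fix w assume "w \<in> space \<mu>"
      then have w: "w \<in> unit_disc" by (simp add: space_\<mu>)
      have mw: "0 < m w" unfolding m_def using measure_\<mu>_ball_pos w by simp
      let ?c = "ennreal ((cmod (poly p w))\<^sup>2) * ennreal (1 / m w)"
      have \<beta>: "?\<beta> w \<in> sets \<nu>"
        using ball_subset_unit_disc[of "1 - cmod w" w]
        by (auto simp: \<nu>(2) sets_restrict_space image_iff intro!: bexI[of _ "?\<beta> w"])
      have "(\<integral>\<^sup>+z. F z w \<partial>\<nu>) \<le> (\<integral>\<^sup>+z. ?c * indicator (?\<beta> w) z \<partial>\<nu>)"
      proof (rule nn_integral_mono)
        fix z
        \<comment> \<open>Here the half radius pays off: \<open>dist z w < (1 - cmod z) / 2\<close>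
          implies \<open>dist w z < 1 - cmod w\<close>.\<close>
        have "cmod w \<le> cmod z + dist z w" by (metis dist_norm norm_minus_commute norm_triangle_sub add.commute)
        then show "F z w \<le> ?c * indicator (?\<beta> w) z"
          by (auto simp: F_def indicator_def dist_commute)
      qed
      also have "\<dots> = ?c * ennreal (measure \<nu> (?\<beta> w))"
        using \<beta> by (simp add: nn_integral_cmult_indicator \<nu>.emeasure_eq_measure)
      also have "\<dots> \<le> ?c * ennreal (M * m w)"
        unfolding m_def by (intro mult_left_mono ennreal_leI M(2) w) auto
      also have "\<dots> = ennreal M * ennreal ((cmod (poly p w))\<^sup>2)"
        using mw M(1) by (simp add: mult_ac flip: ennreal_mult')
      finally show "(\<integral>\<^sup>+z. F z w \<partial>\<nu>) \<le> ennreal M * ennreal ((cmod (poly p w))\<^sup>2)" .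
    qed
    also have "\<dots> = ennreal M * (\<integral>\<^sup>+w. ennreal ((cmod (poly p w))\<^sup>2) \<partial>\<mu>)"
      by (rule nn_integral_cmult) measurable
    finally show ?thesis .
  qed
  have "(\<integral>\<^sup>+z. ennreal ((cmod (poly p z))\<^sup>2) \<partial>\<nu>)
      \<le> (\<integral>\<^sup>+z. ennreal ((16 * C)\<^sup>2) * (\<integral>\<^sup>+w. F z w \<partial>\<mu>) \<partial>\<nu>)"
    using pt by (intro nn_integral_mono) (simp add: space_\<nu>)
  also have "\<dots> = ennreal ((16 * C)\<^sup>2) * (\<integral>\<^sup>+z. (\<integral>\<^sup>+w. F z w \<partial>\<mu>) \<partial>\<nu>)"
    by (rule nn_integral_cmult) measurable
  also have "\<dots> \<le> ennreal ((16 * C)\<^sup>2) * (ennreal M * (\<integral>\<^sup>+w. ennreal ((cmod (poly p w))\<^sup>2) \<partial>\<mu>))"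
    by (intro mult_left_mono integral_F) simp
  also have "\<dots> = ennreal ((16 * C)\<^sup>2 * M) * (\<integral>\<^sup>+w. ennreal ((cmod (poly p w))\<^sup>2) \<partial>\<mu>)"
    using M(1) by (simp only: ennreal_mult mult.assoc zero_le_power2)
  finally show ?thesis .
qed

end

section \<open>Carleson boxes and condition \<open>B\<^sub>2\<close>\<close>

text \<open>Scaled by \<open>pi\<close> so that the length is \<open>2 * pi * h\<close> and the
  Carleson box over it has radial depth exactly \<open>h\<close>; \<open>h = 1\<close> gives the
  full circle.\<close>

definition centered_interval :: "real \<Rightarrow> real \<Rightarrow> real set" where
  "centered_interval \<theta> h = {\<theta> - pi * h .. \<theta> + pi * h}"

lemma measure_centered_interval: "0 \<le> h \<Longrightarrow> measure lborel (centered_interval \<theta> h) = 2 * pi * h"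
  by (simp add: centered_interval_def)

lemma arc_interval_centered: "0 < h \<Longrightarrow> h \<le> 1 \<Longrightarrow> arc_interval (centered_interval \<theta> h)"
  unfolding arc_interval_def measure_centered_interval[OF less_imp_le]
  by (auto simp: centered_interval_def is_interval_cc)

lemma carleson_box_centered:
  "0 < h \<Longrightarrow> carleson_box (centered_interval \<theta> h) =
    {of_real \<rho> * cis t | \<rho> t. \<bar>t - \<theta>\<bar> \<le> pi * h \<and> 1 - h \<le> \<rho> \<and> \<rho> < 1}"
  unfolding carleson_box_def measure_centered_interval[OF less_imp_le]
  by (auto simp: centered_interval_def abs_le_iff algebra_simps)

text \<open>After \<open>\<theta>\<close> is rotated to \<open>0\<close> the point lies within
  \<open>h/2\<close> of \<open>1\<close>. Its real part is then at least \<open>1/2\<close>, and its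
  argument, an arctangent, is at most \<open>h\<close> in absolute value.\<close>

lemma ball_subset_carleson_box:
  assumes "0 < h" "h \<le> 1"
  shows "ball (cis \<theta>) (h / 2) \<inter> unit_disc \<subseteq> carleson_box (centered_interval \<theta> h)"
proof
  fix z assume z: "z \<in> ball (cis \<theta>) (h / 2) \<inter> unit_disc"
  define y where "y = z * cis (- \<theta>)"
  have zy: "z = y * cis \<theta>" by (simp add: y_def mult.assoc cis_mult)
  have norm_y: "cmod y = cmod z" by (simp add: y_def norm_mult)
  have "y - 1 = (z - cis \<theta>) * cis (- \<theta>)" by (simp add: y_def algebra_simps cis_mult)
  then have "cmod (y - 1) = dist (cis \<theta>) z" by (simp add: norm_mult dist_norm norm_minus_commute)
  also have "\<dots> < h / 2" using z by simp
  finally have dist_y: "cmod (y - 1) < h / 2" .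
  have "\<bar>Re (y - 1)\<bar> \<le> cmod (y - 1)" "\<bar>Im (y - 1)\<bar> \<le> cmod (y - 1)"
    by (rule abs_Re_le_cmod, rule abs_Im_le_cmod)
  then have y: "1 / 2 \<le> Re y" "\<bar>Im y\<bar> \<le> h / 2" using dist_y assms by auto
  have "\<bar>Arg y\<bar> = \<bar>arctan (Im y / Re y)\<bar>" using y by (simp add: arg_conv_arctan)
  also have "\<dots> \<le> \<bar>Im y / Re y\<bar>" by (rule abs_arctan_le)
  also have "\<dots> \<le> (h / 2) / (1 / 2)" unfolding abs_divide using y assms by (intro frac_le) auto
  also have "\<dots> \<le> pi * h" using pi_gt3 assms by simp
  finally have "\<bar>(\<theta> + Arg y) - \<theta>\<bar> \<le> pi * h" by simp
  moreover have "z = of_real (cmod z) * cis (\<theta> + Arg y)"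
  proof -
    have "y = of_real (cmod z) * cis (Arg y)"
      using rcis_cmod_Arg[of y] by (simp add: rcis_def norm_y)
    then show ?thesis
      using zy cis_mult[of \<theta> "Arg y"] by (metis mult.assoc mult.commute)
  qed
  moreover have "1 - cmod y \<le> cmod (1 - y)"
    using norm_triangle_ineq2[of 1 y] by simp
  then have "1 - h \<le> cmod z"
    using dist_y norm_y assms norm_minus_commute[of y 1] by linarith
  ultimately show "z \<in> carleson_box (centered_interval \<theta> h)"
    using z unfolding carleson_box_centered[OF assms(1)]
    by (intro CollectI exI[of _ "cmod z"] exI[of _ "\<theta> + Arg y"]) auto
qed

lemma unit_disc_subset_carleson_box: "unit_disc \<subseteq> carleson_box (centered_interval 0 1)"
proof
  fix z :: complex assume z: "z \<in> unit_disc"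
  have "z = of_real (cmod z) * cis (Arg z)" using rcis_cmod_Arg[of z] by (simp add: rcis_def)
  moreover have "\<bar>Arg z - 0\<bar> \<le> pi * 1" using Arg_bounded[of z] by (auto simp: abs_le_iff)
  ultimately show "z \<in> carleson_box (centered_interval 0 1)"
    using z unfolding carleson_box_centered[OF zero_less_one]
    by (intro CollectI exI[of _ "cmod z"] exI[of _ "Arg z"]) auto
qed

lemma dist_cis_le: "dist (cis s) (cis t) \<le> \<bar>s - t\<bar>"
proof -
  have "cis s - cis t = cis t * (cis (s - t) - 1)" by (simp add: algebra_simps cis_mult)
  then have "dist (cis s) (cis t) = cmod (cis (s - t) - 1)" by (simp add: dist_norm norm_mult)
  also have "\<dots> = 2 * \<bar>sin ((s - t) / 2)\<bar>" using dist_exp_i_1[of "s - t"] by (simp add: cis_conv_exp)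
  also have "\<dots> \<le> 2 * \<bar>(s - t) / 2\<bar>" by (intro mult_left_mono abs_sin_x_le_abs_x) auto
  finally show ?thesis by simp
qed

text \<open>A point of the box is reached from \<open>cis \<theta>\<close> along an arc of length at
  most \<open>pi * h\<close> and a radial segment of length at most \<open>h\<close>, and
  \<open>pi + 1 < 6\<close>.\<close>

lemma carleson_box_subset_ball:
  assumes "0 < h" "h \<le> 1"
  shows "carleson_box (centered_interval \<theta> h) \<subseteq> ball (cis \<theta>) (6 * h) \<inter> unit_disc"
proof
  fix z assume "z \<in> carleson_box (centered_interval \<theta> h)"
  then obtain \<rho> t where z: "z = of_real \<rho> * cis t" "\<bar>t - \<theta>\<bar> \<le> pi * h" "1 - h \<le> \<rho>" "\<rho> < 1"
    unfolding carleson_box_centered[OF assms(1)] by blast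
  have "dist (cis \<theta>) z \<le> dist (cis \<theta>) (cis t) + dist (cis t) z" by (rule dist_triangle)
  also have "cis t - z = of_real (1 - \<rho>) * cis t" by (simp add: z algebra_simps)
  then have "dist (cis t) z = \<bar>1 - \<rho>\<bar>" by (simp only: dist_norm norm_mult norm_of_real norm_cis mult_1_right)
  also have "dist (cis \<theta>) (cis t) + \<bar>1 - \<rho>\<bar> \<le> pi * h + h"
    using dist_cis_le[of \<theta> t] z by (simp add: abs_minus_commute)
  also have "\<dots> < 6 * h" using mult_strict_right_mono[of pi 4 h] pi_less_4 assms by simp
  finally have "dist (cis \<theta>) z < 6 * h" .
  moreover have "cmod z < 1" using z assms by (simp add: norm_mult)
  ultimately show "z \<in> ball (cis \<theta>) (6 * h) \<inter> unit_disc" by simp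
qed

text \<open>An upper bound is the useful direction, because the area stands in the denominator of
  condition \<open>B\<^sub>2\<close>. Monotonicity asks for measurability of the larger set, which
  is an intersection of two discs.\<close>

lemma emeasure_carleson_box_le:
  assumes "0 < h" "h \<le> 1"
  shows "emeasure disc_area (carleson_box (centered_interval \<theta> h)) \<le> ennreal (36 * h\<^sup>2)"
proof -
  have "emeasure disc_area (carleson_box (centered_interval \<theta> h))
      \<le> emeasure disc_area (ball (cis \<theta>) (6 * h) \<inter> unit_disc)"
    using carleson_box_subset_ball[OF assms] by (intro emeasure_mono) auto
  also have "\<dots> = emeasure lebesgue (ball (cis \<theta>) (6 * h) \<inter> unit_disc) / ennreal pi"
    by (intro emeasure_disc_area) auto
  also have "\<dots> \<le> emeasure lebesgue (ball (cis \<theta>) (6 * h)) / ennreal pi"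
    by (intro divide_right_mono_ennreal emeasure_mono) auto
  also have "\<dots> = ennreal (36 * h\<^sup>2)"
    using assms by (simp add: emeasure_ball unit_ball_vol_2 divide_ennreal power_mult_distrib)
  finally show ?thesis .
qed

text \<open>If \<open>y = 0\<close> and \<open>x \<noteq> 0\<close>, the quotient is
  \<open>\<top>\<close>, which the finiteness of \<open>c\<close> excludes.\<close>

lemma ennreal_divide_le_imp_le_mult:
  fixes x y c :: ennreal
  assumes "x / y \<le> c" "c < \<top>" "y < \<top>"
  shows "x \<le> c * y"
proof (cases "y = 0")
  case True
  then show ?thesis
    using assms by (cases "x = 0") (auto simp: top_unique)
next
  case False
  then have "x = x / y * y"
    using assms(3) by (simp add: ennreal_divide_times)
  then show ?thesis
    using assms(1) by (metis mult_right_mono zero_le)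
qed

text \<open>A disc with \<open>4 * r \<le> 1\<close> fits into a Carleson box of comparable size; a
  larger one is compared with the box that covers the unit disc. The bound for the whole disc is
  stated separately because it later makes \<open>(1/u) dA\<close> finite.\<close>

lemma B2_condition_balls:
  assumes "B2_condition u"
  obtains C where "1 \<le> C"
    "(\<integral>\<^sup>+z. ennreal (u z) \<partial>disc_area) * (\<integral>\<^sup>+z. ennreal (1 / u z) \<partial>disc_area) \<le> ennreal C"
    "\<And>w r. w \<in> unit_disc \<Longrightarrow> 1 - cmod w \<le> r \<Longrightarrow>
      (\<integral>\<^sup>+z\<in>ball w r \<inter> unit_disc. ennreal (u z) \<partial>disc_area) *
      (\<integral>\<^sup>+z\<in>ball w r \<inter> unit_disc. ennreal (1 / u z) \<partial>disc_area) \<le> ennreal (C * r ^ 4)"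
proof -
  define U where "U E = (\<integral>\<^sup>+z\<in>E. ennreal (u z) \<partial>disc_area)" for E
  define V where "V E = (\<integral>\<^sup>+z\<in>E. ennreal (1 / u z) \<partial>disc_area)" for E
  have mono: "U E * V E \<le> U F * V F" if "E \<subseteq> F" for E F
    unfolding U_def V_def using that
    by (intro mult_mono nn_integral_mono mult_left_mono) (auto simp: indicator_def)
  obtain C where C: "0 < C" "\<And>J. arc_interval J \<Longrightarrow>
      U (carleson_box J) * V (carleson_box J) / (emeasure disc_area (carleson_box J))\<^sup>2 \<le> ennreal C"
    using assms unfolding B2_condition_def U_def V_def by blast
  \<comment> \<open>\<open>1296 = 36\<^sup>2\<close>, from the area bound
    \<open>36 * h\<^sup>2\<close>.\<close>
  have box: "U E * V E \<le> ennreal (1296 * C * h ^ 4)"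
    if h: "0 < h" "h \<le> 1" and E: "E \<subseteq> carleson_box (centered_interval \<theta> h)" for E h \<theta>
  proof -
    let ?S = "carleson_box (centered_interval \<theta> h)"
    have "U E * V E \<le> U ?S * V ?S" by (rule mono[OF E])
    also have "\<dots> \<le> ennreal C * (emeasure disc_area ?S)\<^sup>2"
      using C(2)[OF arc_interval_centered[OF h]]
      by (rule ennreal_divide_le_imp_le_mult) (auto simp: disc_area.emeasure_eq_measure ennreal_power)
    also have "\<dots> \<le> ennreal C * (ennreal (36 * h\<^sup>2))\<^sup>2"
      by (intro mult_left_mono power_mono emeasure_carleson_box_le h) auto
    also have "\<dots> = ennreal C * ennreal ((36 * h\<^sup>2)\<^sup>2)"
      by (subst ennreal_power) auto
    also have "\<dots> = ennreal (C * (36 * h\<^sup>2)\<^sup>2)"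
      using C(1) by (intro ennreal_mult[symmetric]) auto
    also have "C * (36 * h\<^sup>2)\<^sup>2 = 1296 * C * h ^ 4"
      by (simp add: power_mult_distrib flip: power_mult)
    finally show ?thesis .
  qed
  have disc: "U E * V E \<le> ennreal (1296 * C)" if "E \<subseteq> unit_disc" for E
    using box[of 1 E 0] that unit_disc_subset_carleson_box by auto
  \<comment> \<open>\<open>256 = 4^4\<close> pays for boxes of parameter \<open>4 * r\<close> when
    \<open>r\<close> is small; when \<open>r\<close> is large, \<open>(4 * r) ^ 4 \<ge> 1\<close>
    absorbs the missing power of \<open>r\<close>.\<close>
  define C' where "C' = max 1 (1296 * C * 256)"
  have C': "1 \<le> C'" "1296 * C * 256 \<le> C'" by (auto simp: C'_def)
  show thesis
  proof
    show "1 \<le> C'" by fact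
    have "U unit_disc = (\<integral>\<^sup>+z. ennreal (u z) \<partial>disc_area)" "V unit_disc = (\<integral>\<^sup>+z. ennreal (1 / u z) \<partial>disc_area)"
      unfolding U_def V_def by (auto intro!: nn_integral_cong simp: space_disc_area)
    moreover have "ennreal (1296 * C) \<le> ennreal C'"
      using C(1) C'(2) by (intro ennreal_leI) simp
    ultimately show "(\<integral>\<^sup>+z. ennreal (u z) \<partial>disc_area) * (\<integral>\<^sup>+z. ennreal (1 / u z) \<partial>disc_area) \<le> ennreal C'"
      using order_trans[OF disc[OF order_refl]] by metis
  next
    fix w :: complex and r :: real
    assume w: "w \<in> unit_disc" "1 - cmod w \<le> r"
    have r: "0 < r" using w by auto
    let ?K = "ball w r \<inter> unit_disc"
    have "U ?K * V ?K \<le> ennreal (C' * r ^ 4)"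
    proof (cases "4 * r \<le> 1")
      case True
      \<comment> \<open>The boundary point \<open>cis (Arg w)\<close> is within \<open>r\<close> of
        \<open>w\<close>, so the disc about \<open>w\<close> lies in the disc of radius
        \<open>2 * r\<close> about that point.\<close>
      have "w = of_real (cmod w) * cis (Arg w)" using rcis_cmod_Arg[of w] by (simp add: rcis_def)
      then have "w - cis (Arg w) = of_real (cmod w - 1) * cis (Arg w)" by (simp add: algebra_simps)
      then have "dist (cis (Arg w)) w = \<bar>cmod w - 1\<bar>"
        by (simp only: dist_norm norm_minus_commute[of "cis (Arg w)"] norm_mult norm_of_real norm_cis mult_1_right)
      then have "dist (cis (Arg w)) w \<le> r" using w by simp
      then have "ball w r \<subseteq> ball (cis (Arg w)) (4 * r / 2)"
        using dist_triangle[of "cis (Arg w)" _ w] by (auto simp: dist_commute) (smt (verit))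
      then have "?K \<subseteq> carleson_box (centered_interval (Arg w) (4 * r))"
        using ball_subset_carleson_box[of "4 * r" "Arg w"] True r by auto
      then have "U ?K * V ?K \<le> ennreal (1296 * C * (4 * r) ^ 4)"
        using True r by (intro box) auto
      also have "\<dots> \<le> ennreal (C' * r ^ 4)"
        using mult_right_mono[OF C'(2), of "r ^ 4"] by (intro ennreal_leI) (simp add: power_mult_distrib)
      finally show ?thesis .
    next
      case False
      have "U ?K * V ?K \<le> ennreal (1296 * C)" by (rule disc) simp
      also have "\<dots> \<le> ennreal (C' * r ^ 4)"
      proof (rule ennreal_leI)
        have "1 \<le> (4 * r) ^ 4" using False by (intro one_le_power) auto
        then have "1296 * C * 1 \<le> 1296 * C * (4 * r) ^ 4" using C(1) by (intro mult_left_mono) auto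
        also have "\<dots> = 1296 * C * 256 * r ^ 4" by (simp add: power_mult_distrib)
        also have "\<dots> \<le> C' * r ^ 4" by (intro mult_right_mono C'(2)) simp
        finally show "1296 * C \<le> C' * r ^ 4" by simp
      qed
      finally show ?thesis .
    qed
    then show "(\<integral>\<^sup>+z\<in>?K. ennreal (u z) \<partial>disc_area) * (\<integral>\<^sup>+z\<in>?K. ennreal (1 / u z) \<partial>disc_area)
        \<le> ennreal (C' * r ^ 4)"
      unfolding U_def V_def .
  qed
qed

section \<open>The weight and its reciprocal as a Bekolle-Bonami pair\<close>

text \<open>\<open>g\<close> is split as \<open>g * sqrt u\<close> times
  \<open>sqrt (1 / u)\<close>, which is legitimate almost everywhere because \<open>u\<close> is
  positive there.\<close>

lemma cauchy_schwarz_weight: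
  assumes u [measurable]: "u \<in> borel_measurable disc_area" and pos: "AE z in disc_area. 0 < u z"
    and E: "E \<in> sets disc_area" and g: "g \<in> borel_measurable borel"
  shows "(\<integral>\<^sup>+z\<in>E. g z \<partial>disc_area)\<^sup>2 \<le>
    (\<integral>\<^sup>+z\<in>E. (g z)\<^sup>2 \<partial>density disc_area (\<lambda>z. ennreal (u z))) *
    emeasure (density disc_area (\<lambda>z. ennreal (1 / u z))) E"
proof -
  have [measurable]: "g \<in> borel_measurable disc_area"
    using g by (rule borel_measurable_disc_area) simp
  note E [measurable]
  let ?f = "\<lambda>z. g z * ennreal (sqrt (u z)) * indicator E z"
  let ?g = "\<lambda>z. ennreal (sqrt (1 / u z)) * indicator E z"
  have "(\<integral>\<^sup>+z\<in>E. g z \<partial>disc_area) = (\<integral>\<^sup>+z. ?f z * ?g z \<partial>disc_area)"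
  proof (rule nn_integral_cong_AE)
    show "AE z in disc_area. g z * indicator E z = ?f z * ?g z"
      using pos
    proof eventually_elim
      case (elim z)
      then have "ennreal (sqrt (u z)) * ennreal (sqrt (1 / u z)) = 1"
        by (simp add: real_sqrt_divide flip: ennreal_mult')
      then show ?case
        by (simp add: indicator_def mult.assoc)
    qed
  qed
  also have "(\<dots>)\<^sup>2 \<le> (\<integral>\<^sup>+z. (?f z)\<^sup>2 \<partial>disc_area) * (\<integral>\<^sup>+z. (?g z)\<^sup>2 \<partial>disc_area)"
    by (rule Cauchy_Schwarz_nn_integral) measurable
  also have "(\<integral>\<^sup>+z. (?f z)\<^sup>2 \<partial>disc_area) =
      (\<integral>\<^sup>+z\<in>E. (g z)\<^sup>2 \<partial>density disc_area (\<lambda>z. ennreal (u z)))"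
  proof (subst nn_integral_density)
    show "(\<integral>\<^sup>+z. (?f z)\<^sup>2 \<partial>disc_area) = (\<integral>\<^sup>+z. ennreal (u z) * ((g z)\<^sup>2 * indicator E z) \<partial>disc_area)"
    proof (rule nn_integral_cong_AE)
      show "AE z in disc_area. (?f z)\<^sup>2 = ennreal (u z) * ((g z)\<^sup>2 * indicator E z)"
        using pos by eventually_elim (simp add: power_mult_distrib ennreal_power indicator_def mult_ac)
    qed
  qed measurable
  also have "(\<integral>\<^sup>+z. (?g z)\<^sup>2 \<partial>disc_area) = emeasure (density disc_area (\<lambda>z. ennreal (1 / u z))) E"
  proof (subst emeasure_density)
    show "(\<integral>\<^sup>+z. (?g z)\<^sup>2 \<partial>disc_area) = (\<integral>\<^sup>+z. ennreal (1 / u z) * indicator E z \<partial>disc_area)"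
    proof (rule nn_integral_cong_AE)
      show "AE z in disc_area. (?g z)\<^sup>2 = ennreal (1 / u z) * indicator E z"
        using pos by eventually_elim (simp add: power_mult_distrib ennreal_power indicator_def)
    qed
  qed measurable
  finally show ?thesis .
qed

lemma bekolle_pair_density:
  assumes u: "disc_weight u" and B2: "B2_condition u"
    and prob: "prob_space (density disc_area (\<lambda>z. ennreal (u z)))"
  obtains C where
    "bekolle_pair (density disc_area (\<lambda>z. ennreal (u z))) (density disc_area (\<lambda>z. ennreal (1 / u z))) C"
proof -
  let ?\<mu> = "density disc_area (\<lambda>z. ennreal (u z))" and ?\<kappa> = "density disc_area (\<lambda>z. ennreal (1 / u z))"
  have [measurable]: "u \<in> borel_measurable disc_area" and pos: "AE z in disc_area. 0 < u z"
    using u by (auto simp: disc_weight_def)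
  obtain C where C: "1 \<le> C"
    "(\<integral>\<^sup>+z. ennreal (u z) \<partial>disc_area) * (\<integral>\<^sup>+z. ennreal (1 / u z) \<partial>disc_area) \<le> ennreal C"
    "\<And>w r. w \<in> unit_disc \<Longrightarrow> 1 - cmod w \<le> r \<Longrightarrow>
      (\<integral>\<^sup>+z\<in>ball w r \<inter> unit_disc. ennreal (u z) \<partial>disc_area) *
      (\<integral>\<^sup>+z\<in>ball w r \<inter> unit_disc. ennreal (1 / u z) \<partial>disc_area) \<le> ennreal (C * r ^ 4)"
    using B2_condition_balls[OF B2] by blast
  interpret \<mu>: prob_space ?\<mu> by (rule prob)
  have total: "emeasure ?\<kappa> (space ?\<kappa>) = (\<integral>\<^sup>+z. ennreal (1 / u z) \<partial>disc_area)"
    "emeasure ?\<mu> (space ?\<mu>) = (\<integral>\<^sup>+z. ennreal (u z) \<partial>disc_area)"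
    by (subst emeasure_density; auto intro!: nn_integral_cong)+
  \<comment> \<open>Since \<open>\<mu>\<close> has total mass \<open>1\<close>, the bound on the
    product of the total masses bounds the mass of \<open>\<kappa>\<close> by
    \<open>C\<close>.\<close>
  have fin: "finite_measure ?\<kappa>"
  proof
    have "emeasure ?\<kappa> (space ?\<kappa>) \<le> ennreal C"
      using C(2) \<mu>.emeasure_space_1 unfolding total by simp
    then show "emeasure ?\<kappa> (space ?\<kappa>) \<noteq> \<infinity>" by (auto simp: top_unique)
  qed
  then interpret \<kappa>: finite_measure ?\<kappa> .
  have "bekolle_pair ?\<mu> ?\<kappa> C"
  proof
    show "sets ?\<mu> = sets disc_area" "sets ?\<kappa> = sets disc_area" by simp_all
    show "1 \<le> C" by (rule C(1))
    show "(\<integral>\<^sup>+z\<in>E. g z \<partial>disc_area)\<^sup>2 \<le> (\<integral>\<^sup>+z\<in>E. (g z)\<^sup>2 \<partial>?\<mu>) * emeasure ?\<kappa> E"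
      if "E \<in> sets disc_area" "g \<in> borel_measurable borel" for E g
      by (rule cauchy_schwarz_weight) (use that pos in auto)
    show "measure ?\<mu> (ball w r \<inter> unit_disc) * measure ?\<kappa> (ball w r \<inter> unit_disc) \<le> C * r ^ 4"
      if w: "w \<in> unit_disc" "1 - cmod w \<le> r" for w r
    proof -
      have [measurable]: "ball w r \<inter> unit_disc \<in> sets disc_area" by simp
      have "emeasure ?\<mu> (ball w r \<inter> unit_disc) * emeasure ?\<kappa> (ball w r \<inter> unit_disc) \<le> ennreal (C * r ^ 4)"
        using C(3)[OF w] by (simp add: emeasure_density)
      then have "ennreal (measure ?\<mu> (ball w r \<inter> unit_disc) * measure ?\<kappa> (ball w r \<inter> unit_disc)) \<le> ennreal (C * r ^ 4)"
        unfolding \<mu>.emeasure_eq_measure \<kappa>.emeasure_eq_measure by (simp add: ennreal_mult)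
      then show ?thesis
        using C(1) by (subst (asm) ennreal_le_iff) auto
    qed
  qed
  then show thesis by (rule that)
qed

section \<open>From a bounded Berezin transform to the Carleson property\<close>

theorem proposition3p3:
  fixes u :: "complex \<Rightarrow> real" and \<mu> \<nu> :: "complex measure"
  assumes "disc_weight u"
    and "B2_condition u"
    and "\<mu> = density disc_area (\<lambda>z. ennreal (u z))"
    and "prob_space \<mu>"
    and "sets \<nu> = sets (restrict_space borel unit_disc)"
    and "prob_space \<nu>"
    and "bounded (berezin_transform u \<nu> ` unit_disc)"
  shows "carleson_measure \<mu> \<nu>"
proof -
  obtain C where "bekolle_pair \<mu> (density disc_area (\<lambda>z. ennreal (1 / u z))) C"
    using bekolle_pair_density assms(1-4) by metis
  then interpret bekolle_pair \<mu> "density disc_area (\<lambda>z. ennreal (1 / u z))" C .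
  interpret \<mu>: prob_space \<mu> by fact
  interpret \<nu>: prob_space \<nu> by fact
  have u_meas [measurable]: "u \<in> borel_measurable disc_area" and pos: "AE z in disc_area. 0 < u z"
    using assms(1) by (auto simp: disc_weight_def)
  have space_\<nu>: "space \<nu> = unit_disc"
    using sets_eq_imp_space_eq[OF assms(5)] by (simp add: space_restrict_space)
  obtain M where M: "\<And>a. a \<in> unit_disc \<Longrightarrow> \<bar>berezin_transform u \<nu> a\<bar> \<le> M"
    using assms(7) unfolding bounded_iff by (metis imageI real_norm_def)
  have M0: "0 \<le> M" using M[of 0] by auto
  \<comment> \<open>On the disc of radius \<open>h\<close> about \<open>a\<close> the squared kernel
    is at least \<open>1 / (3 * h) ^ 4\<close>, and \<open>81 = 3^4\<close>. The
    \<open>\<nu>\<close>-mass of the disc is thus controlled by the Berezin transform times the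
    squared norm of the kernel.\<close>
  have ball_bound: "measure \<nu> (ball a (1 - cmod a)) \<le> 81 * M * kernel_bound * measure \<mu> (ball a (1 - cmod a))"
    if a: "a \<in> unit_disc" for a
  proof -
    define h where "h = 1 - cmod a"
    have h0: "0 < h" using a by (simp add: h_def)
    let ?B = "\<lambda>z. (cmod (bergman_kernel a z))\<^sup>2"
    have B_le: "?B z \<le> 1 / h ^ 4" if "z \<in> unit_disc" for z
      using bergman_denominator_bounds(1)[OF a that] h0 by (intro bergman_kernel_le) (auto simp: h_def)
    have B_ge: "1 / d ^ 4 \<le> ?B z" if z: "z \<in> unit_disc" "cmod (1 - cnj a * z) \<le> d" for z d
      unfolding norm_bergman_kernel
      using bergman_denominator_bounds(1)[OF a z(1)] z(2) h0
      by (intro divide_left_mono power_mono mult_pos_pos zero_less_power) (auto simp: h_def)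
    have B_\<mu>: "?B \<in> borel_measurable \<mu>" and B_area [measurable]: "?B \<in> borel_measurable disc_area"
      and B_\<nu>: "?B \<in> borel_measurable \<nu>"
    proof -
      have B: "?B \<in> borel_measurable borel" by measurable
      show "?B \<in> borel_measurable \<mu>" "?B \<in> borel_measurable disc_area"
        using B by (auto intro: measurable_\<mu> borel_measurable_disc_area)
      show "?B \<in> borel_measurable \<nu>"
        using measurable_restrict_space1[OF B] measurable_cong_sets[OF assms(5) refl] by blast
    qed
    \<comment> \<open>The kernel is bounded on the disc, so the Bochner integrals do not fall back
      on the default value \<open>0\<close>.\<close>
    have int_\<mu>: "integrable \<mu> ?B"
      using B_le B_\<mu> by (intro \<mu>.integrable_const_bound[where B = "1 / h ^ 4"]) (auto intro!: AE_I2 simp: space_\<mu>)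
    have int_\<nu>: "integrable \<nu> ?B"
      using B_le B_\<nu> by (intro \<nu>.integrable_const_bound[where B = "1 / h ^ 4"]) (auto intro!: AE_I2 simp: space_\<nu>)
    define N where "N = (\<integral>z. ?B z \<partial>\<mu>)"
    have N_eq: "(A2_norm u (bergman_kernel a))\<^sup>2 = N"
    proof -
      have "N = (\<integral>z. u z * ?B z \<partial>disc_area)"
        unfolding N_def assms(3) using pos
        by (subst integral_density) (auto elim!: eventually_mono)
      moreover have "0 \<le> N" unfolding N_def by (intro integral_nonneg_AE) auto
      ultimately show ?thesis
        by (simp add: A2_norm_def mult.commute)
    qed
    \<comment> \<open>With \<open>N = 0\<close> the quotient in the Berezin transform would be
      \<open>0\<close> by convention and would say nothing about \<open>\<nu>\<close>. The bound
      \<open>|1 - cnj a * z| \<le> 2\<close> excludes this.\<close>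
    have N_pos: "0 < N"
    proof -
      have "(\<integral>z. 1 / 2 ^ 4 \<partial>\<mu>) \<le> N"
        unfolding N_def
      proof (rule integral_mono[OF _ int_\<mu>])
        fix z assume "z \<in> space \<mu>"
        then have z: "z \<in> unit_disc" by (simp add: space_\<mu>)
        have "cmod (1 - cnj a * z) \<le> 1 + cmod a * cmod z"
          using norm_triangle_ineq4[of 1 "cnj a * z"] by (simp add: norm_mult)
        also have "cmod a * cmod z \<le> 1 * 1" using a z by (intro mult_mono) auto
        finally show "1 / 2 ^ 4 \<le> ?B z" using z by (intro B_ge) auto
      qed simp
      then show ?thesis by (simp add: \<mu>.prob_space)
    qed
    have N_le: "N \<le> kernel_bound * (measure \<mu> (ball a h) / h ^ 4)"
    proof -
      have "ennreal N = (\<integral>\<^sup>+z. ennreal (?B z) \<partial>\<mu>)"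
        unfolding N_def by (rule nn_integral_eq_integral[symmetric]) (use int_\<mu> in auto)
      also have "\<dots> \<le> ennreal (kernel_bound * (measure \<mu> (ball a h) / h ^ 4))"
        by (rule nn_integral_bergman_kernel_le[OF a h_def])
      finally show ?thesis
        using h0 kernel_bound_nonneg by (subst (asm) ennreal_le_iff) auto
    qed
    have \<beta>: "ball a h \<in> sets \<nu>"
      using ball_subset_unit_disc[of h a]
      by (auto simp: h_def assms(5) sets_restrict_space image_iff intro!: bexI[of _ "ball a (1 - cmod a)"])
    have "measure \<nu> (ball a h) / (81 * h ^ 4) = (\<integral>z. 1 / (81 * h ^ 4) * indicator (ball a h) z \<partial>\<nu>)"
      using \<beta> sets.sets_into_space[OF \<beta>] by (simp add: Int_absorb2)
    also have "\<dots> \<le> (\<integral>z. ?B z \<partial>\<nu>)"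
    proof (rule integral_mono[OF _ int_\<nu>])
      show "integrable \<nu> (\<lambda>z. 1 / (81 * h ^ 4) * indicator (ball a h) z :: real)"
        using \<beta> by (intro integrable_mult_right integrable_real_indicator) (auto simp: \<nu>.emeasure_eq_measure)
      fix z assume "z \<in> space \<nu>"
      then have z: "z \<in> unit_disc" by (simp add: space_\<nu>)
      show "1 / (81 * h ^ 4) * indicator (ball a h) z \<le> ?B z"
      proof (cases "z \<in> ball a h")
        case True
        then have "cmod (1 - cnj a * z) \<le> 3 * h"
          using bergman_denominator_bounds(3)[OF a z] by (simp add: h_def dist_norm norm_minus_commute)
        from B_ge[OF z this] show ?thesis using True by (simp add: power_mult_distrib)
      qed simp
    qed
    also have "\<dots> \<le> M * N"
    proof -
      have "(\<integral>z. ?B z \<partial>\<nu>) = berezin_transform u \<nu> a * N"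
        using N_pos by (simp add: berezin_transform_def N_eq)
      also have "\<dots> \<le> M * N" using M[OF a] N_pos by (intro mult_right_mono) auto
      finally show ?thesis .
    qed
    also have "\<dots> \<le> M * (kernel_bound * (measure \<mu> (ball a h) / h ^ 4))"
      by (intro mult_left_mono N_le M0)
    finally show ?thesis
      using h0 unfolding h_def[symmetric] by (simp add: field_simps)
  qed
  \<comment> \<open>\<open>K\<close> may vanish, while a Carleson constant has to be positive; hence
    \<open>K + 1\<close> below.\<close>
  define K where "K = (16 * C)\<^sup>2 * (81 * M * kernel_bound)"
  have "(\<integral>\<^sup>+z. ennreal ((cmod (poly p z))\<^sup>2) \<partial>\<nu>)
      \<le> ennreal (K + 1) * (\<integral>\<^sup>+z. ennreal ((cmod (poly p z))\<^sup>2) \<partial>\<mu>)" for p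
  proof -
    have "(\<integral>\<^sup>+z. ennreal ((cmod (poly p z))\<^sup>2) \<partial>\<nu>)
        \<le> ennreal K * (\<integral>\<^sup>+z. ennreal ((cmod (poly p z))\<^sup>2) \<partial>\<mu>)"
      unfolding K_def
      by (rule carleson_of_ball_bound)
        (use assms(5) ball_bound M0 kernel_bound_nonneg \<nu>.finite_measure_axioms in auto)
    also have "\<dots> \<le> ennreal (K + 1) * (\<integral>\<^sup>+z. ennreal ((cmod (poly p z))\<^sup>2) \<partial>\<mu>)"
      by (intro mult_right_mono ennreal_leI) auto
    finally show ?thesis .
  qed
  moreover have "0 < K + 1"
    unfolding K_def using M0 kernel_bound_nonneg by (intro add_nonneg_pos mult_nonneg_nonneg) auto
  ultimately show ?thesis
    unfolding carleson_measure_def by blast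
qed

end
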